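(* For each $\epsilon>0$ there exists $\delta=\delta(\epsilon)>0$ such that whenever $\beta>0$ and $\Delta\in(0,1)$ satisfy $(\beta J)\Delta^2\ge1/\delta$ and $(\beta J)\Delta^3\le\delta$, then $$\limsup_{L\to\infty}\bigl|F^{(\Delta)}_{L,\beta}(\theta^\star)-F(\theta^\star)\bigr|\le\epsilon\qquad\text{for all }\theta^\star\in[0,2\pi).$$
   Context: On the torus $\mathbb T_L=\mathbb Z^3/(L\mathbb Z)^3$, write spins as angles $\boldsymbol\theta=(\theta_{\boldsymbol r})$, $\boldsymbol S_{\boldsymbol r}=(\cos\theta_{\boldsymbol r},\sin\theta_{\boldsymbol r})$, and let $\mathscr H_L(\boldsymbol\theta)=\frac J2\sum_{\boldsymbol r\in\mathbb T_L}\bigl[(\cos\theta_{\boldsymbol r}-\cos\theta_{\boldsymbol r+\hat{\mathrm e}_1})^2+(\cos(\theta_{\boldsymbol r}-\tfrac{2\pi}3)-\cos(\theta_{\boldsymbol r+\hat{\mathrm e}_2}-\tfrac{2\pi}3))^2+(\cos(\theta_{\boldsymbol r}+\tfrac{2\pi}3)-\cos(\theta_{\boldsymbol r+\hat{\mathrm e}_3}+\tfrac{2\pi}3))^2\bigr]$, $J>0$. Let $\chi_{\Delta,L}(\boldsymbol\theta)$ be the indicator that $|\theta_{\boldsymbol r}-\theta^\star|<\Delta$ (difference mod $2\pi$) for all $\boldsymbol r\in\mathbb T_L$. Define $F^{(\Delta)}_{L,\beta}(\theta^\star)=-\frac12\log\frac{\beta J}{2\pi}-\frac1{L^3}\log\int_{[0,2\pi)^{\mathbb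 T_L}}e^{-\beta\mathscr H_L(\boldsymbol\theta)}\chi_{\Delta,L}(\boldsymbol\theta)\prod_{\boldsymbol r}d\theta_{\boldsymbol r}$. With $q_1=\sin^2\theta^\star$, $q_2=\sin^2(\theta^\star-\tfrac{2\pi}3)$, $q_3=\sin^2(\theta^\star+\tfrac{2\pi}3)$, define the spin-wave free energy $F(\theta^\star)=\frac12\int_{[-\pi,\pi]^3}\frac{d\boldsymbol k}{(2\pi)^3}\log\Bigl\{\sum_{\alpha=1}^3q_\alpha|1-e^{ik_\alpha}|^2\Bigr\}$. *)

theory Defs
  imports "HOL-Analysis.Analysis"
begin

text \<open>Sites of the torus T_L = Z^3/(LZ)^3, represented by triples with coordinates in {0..<L}.\<close>
definition torus :: "nat \<Rightarrow> (nat \<times> nat \<times> nat) set" where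
  "torus L = {0..<L} \<times> {0..<L} \<times> {0..<L}"

definition shift1 :: "nat \<Rightarrow> nat \<times> nat \<times> nat \<Rightarrow> nat \<times> nat \<times> nat" where
  "shift1 L r = (case r of (i, j, k) \<Rightarrow> ((i + 1) mod L, j, k))"
definition shift2 :: "nat \<Rightarrow> nat \<times> nat \<times> nat \<Rightarrow> nat \<times> nat \<times> nat" where
  "shift2 L r = (case r of (i, j, k) \<Rightarrow> (i, (j + 1) mod L, k))"
definition shift3 :: "nat \<Rightarrow> nat \<times> nat \<times> nat \<Rightarrow> nat \<times> nat \<times> nat" where
  "shift3 L r = (case r of (i, j, k) \<Rightarrow> (i, j, (k + 1) mod L))"

definition hamiltonian :: "real \<Rightarrow> nat \<Rightarrow> (nat \<times> nat \<times> nat \<Rightarrow> real) \<Rightarrow> real" where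
  "hamiltonian J L \<theta> = J / 2 * (\<Sum>r\<in>torus L.
      (cos (\<theta> r) - cos (\<theta> (shift1 L r)))\<^sup>2
    + (cos (\<theta> r - 2*pi/3) - cos (\<theta> (shift2 L r) - 2*pi/3))\<^sup>2
    + (cos (\<theta> r + 2*pi/3) - cos (\<theta> (shift3 L r) + 2*pi/3))\<^sup>2)"

definition chi :: "real \<Rightarrow> real \<Rightarrow> nat \<Rightarrow> (nat \<times> nat \<times> nat \<Rightarrow> real) \<Rightarrow> real" where
  "chi \<Delta> \<theta>s L \<theta> =
     (if \<forall>r\<in>torus L. \<exists>n::int. \<bar>\<theta> r - \<theta>s - 2 * pi * of_int n\<bar> < \<Delta> then 1 else 0)"

definition config_measure :: "nat \<Rightarrow> (nat \<times> nat \<times> nat \<Rightarrow> real) measure" where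
  "config_measure L = PiM (torus L) (\<lambda>_. restrict_space lborel {0..<2*pi})"

definition restricted_free_energy ::
  "real \<Rightarrow> real \<Rightarrow> real \<Rightarrow> nat \<Rightarrow> real \<Rightarrow> real" where
  "restricted_free_energy J \<Delta> \<beta> L \<theta>s =
     - (1/2) * ln (\<beta> * J / (2*pi))
     - (1 / real L ^ 3) * ln (integral\<^sup>L (config_measure L)
          (\<lambda>\<theta>. exp (- \<beta> * hamiltonian J L \<theta>) * chi \<Delta> \<theta>s L \<theta>))"

definition spin_wave_free_energy :: "real \<Rightarrow> real" where
  "spin_wave_free_energy \<theta>s =
     (let q1 = (sin \<theta>s)\<^sup>2; q2 = (sin (\<theta>s - 2*pi/3))\<^sup>2; q3 = (sin (\<theta>s + 2*pi/3))\<^sup>2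
      in 1/2 * (LINT k : {-pi..pi} \<times> {-pi..pi} \<times> {-pi..pi} | lborel.
           ln (q1 * (cmod (1 - cis (fst k)))\<^sup>2 + q2 * (cmod (1 - cis (fst (snd k))))\<^sup>2
               + q3 * (cmod (1 - cis (snd (snd k))))\<^sup>2) / (2*pi)^3))"

end

theory Submission
  imports Defs "HOL-Probability.Distributions" "HOL-Library.Real_Mod" "Jordan_Normal_Form.Determinant"
begin

text \<open>
  For angles within \<open>\<Delta>\<close> of \<open>\<theta>\<^sup>\<star>\<close>, replacing the Hamiltonian by its quadratic part costs \<open>O(\<beta> J \<Delta>\<^sup>3)\<close>
  per site in the exponent. The constraint \<open>\<bar>\<phi>\<^sub>r\<bar> < \<Delta>\<close> on the deviations is then traded for a mass term on both sides.
  From above, the indicator is at most \<open>exp (\<lambda> (\<Delta>\<^sup>2 - \<phi>\<^sub>r\<^sup>2) / 2)\<close> for every \<open>\<lambda> > 0\<close>. From below, substitute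
  \<open>\<phi>\<^sub>r = h (\<eta>\<^sub>r)\<close> with \<open>h (x) = arctan (c x) / c\<close> and \<open>c = \<pi> / (2 \<Delta>)\<close>: since \<open>h\<close> is a contraction of the line
  onto \<open>(-\<Delta>, \<Delta>)\<close>, the gradient energy does not increase, and the Jacobian \<open>1 / (1 + (c x)\<^sup>2)\<close> is at least
  \<open>exp (- (c x)\<^sup>2)\<close>. Both bounds are massive Gaussian integrals, diagonalised by the real
  Fourier (Hartley) basis \<open>cos + sin\<close>; the logarithms of their eigenvalues form Riemann sums of
  \<open>ln (D (k) + m)\<close>, where \<open>m\<close> is of order \<open>1 / (\<beta> J \<Delta>\<^sup>2)\<close>. As \<open>m \<rightarrow> 0\<close> these integrals converge uniformly
  in \<open>\<theta>\<^sup>\<star>\<close>, because one of the three stiffnesses is always at least \<open>1/2\<close>, which makes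
  \<open>ln (1 + m / D (k))\<close> at most of order \<open>m\<^bsup>1/4\<^esup> \<bar>k\<^sub>\<alpha>\<bar>\<^bsup>-1/2\<^esup>\<close> for some coordinate \<open>\<alpha>\<close>.
\<close>
subsection \<open>Gaussian integrals over finite index sets\<close>

definition quadratic_form :: "'a set \<Rightarrow> ('a \<Rightarrow> 'a \<Rightarrow> real) \<Rightarrow> ('a \<Rightarrow> real) \<Rightarrow> real" where
  "quadratic_form I A x = (\<Sum>i\<in>I. \<Sum>j\<in>I. A i j * x i * x j)"

definition positive_definite_on :: "'a set \<Rightarrow> ('a \<Rightarrow> 'a \<Rightarrow> real) \<Rightarrow> bool" where
  "positive_definite_on I A \<longleftrightarrow>
     (\<forall>i\<in>I. \<forall>j\<in>I. A i j = A j i) \<and> (\<forall>x. (\<exists>i\<in>I. x i \<noteq> 0) \<longrightarrow> 0 < quadratic_form I A x)"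

definition gaussian_integral :: "'a set \<Rightarrow> ('a \<Rightarrow> 'a \<Rightarrow> real) \<Rightarrow> ennreal" where
  "gaussian_integral I A = (\<integral>\<^sup>+x. ennreal (exp (- (quadratic_form I A x / 2))) \<partial>PiM I (\<lambda>_. lborel))"

definition schur_complement :: "'a \<Rightarrow> ('a \<Rightarrow> 'a \<Rightarrow> 'b::field) \<Rightarrow> 'a \<Rightarrow> 'a \<Rightarrow> 'b" where
  "schur_complement z A i j = A i j - A i z * A z j / A z z"

definition matrix_on :: "'a list \<Rightarrow> ('a \<Rightarrow> 'a \<Rightarrow> 'b) \<Rightarrow> 'b mat" where
  "matrix_on xs A = Matrix.mat (length xs) (length xs) (\<lambda>(i, j). A (xs ! i) (xs ! j))"

lemma quadratic_form_cong:
  "(\<And>i. i \<in> I \<Longrightarrow> x i = y i) \<Longrightarrow> quadratic_form I A x = quadratic_form I A y"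
  unfolding quadratic_form_def by (intro sum.cong refl) simp_all

lemma quadratic_form_measurable [measurable]:
  "quadratic_form I A \<in> borel_measurable (PiM I (\<lambda>_. lborel))"
  unfolding quadratic_form_def[abs_def] by measurable

lemma det_matrix_on_snoc:
  fixes A :: "'a \<Rightarrow> 'a \<Rightarrow> 'b::field"
  assumes "A z z \<noteq> 0"
  shows "Determinant.det (matrix_on (xs @ [z]) A)
       = A z z * Determinant.det (matrix_on xs (schur_complement z A))"
proof -
  define n where "n = length xs"
  define S where "S = matrix_on xs (schur_complement z A)"
  define B where "B = Matrix.mat n 1 (\<lambda>(i, j). A (xs ! i) z)"
  define C where "C = Matrix.mat 1 n (\<lambda>(i, j). A z (xs ! j) / A z z)"
  define D where "D = Matrix.mat 1 1 (\<lambda>(i, j). A z z)"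
  have carrier: "S \<in> carrier_mat n n" "B \<in> carrier_mat n 1"
      "C \<in> carrier_mat 1 n" "D \<in> carrier_mat 1 1"
    by (simp_all add: S_def B_def C_def D_def n_def matrix_on_def)
  let ?U = "four_block_mat S B (0\<^sub>m 1 n) D" and ?L = "four_block_mat (1\<^sub>m n) (0\<^sub>m n 1) C (1\<^sub>m 1)"
  have "?U * ?L = four_block_mat (S * 1\<^sub>m n + B * C) (S * 0\<^sub>m n 1 + B * 1\<^sub>m 1)
      (0\<^sub>m 1 n * 1\<^sub>m n + D * C) (0\<^sub>m 1 n * 0\<^sub>m n 1 + D * 1\<^sub>m 1)"
    by (rule mult_four_block_mat) (use carrier in auto)
  also have "\<dots> = four_block_mat (S + B * C) B (D * C) D"
    using carrier by simp
  also have "\<dots> = matrix_on (xs @ [z]) A"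
    using assms carrier
    by (intro eq_matI) (auto simp: S_def B_def C_def D_def n_def matrix_on_def schur_complement_def
        scalar_prod_def nth_append less_Suc_eq)
  finally have factorization: "matrix_on (xs @ [z]) A = ?U * ?L" ..
  have "Determinant.det ?U = Determinant.det S * A z z"
    using det_four_block_mat_lower_left_zero[OF carrier(1,2) refl carrier(4)]
      det_single[OF carrier(4)]
    by (simp add: D_def)
  moreover have "Determinant.det ?L = 1"
    using det_four_block_mat_upper_right_zero[OF one_carrier_mat refl carrier(3) one_carrier_mat]
    by simp
  moreover have "Determinant.det (?U * ?L) = Determinant.det ?U * Determinant.det ?L"
    by (rule det_mult[of _ "n + 1"]) (use carrier in auto)
  ultimately show ?thesis
    by (simp add: factorization S_def mult.commute)
qed

lemma quadratic_form_insert: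
  assumes I: "finite I" "z \<notin> I" and A: "A z z \<noteq> 0" and sym: "\<And>i. i \<in> I \<Longrightarrow> A i z = A z i"
  shows "quadratic_form (insert z I) A x
    = A z z * (x z + (\<Sum>i\<in>I. A z i * x i) / A z z)\<^sup>2 + quadratic_form I (schur_complement z A) x"
proof -
  define S where "S = (\<Sum>i\<in>I. A z i * x i)"
  have S: "(\<Sum>i\<in>I. A i z * x i) = S"
    by (simp add: S_def sym)
  have "S * S / A z z = (\<Sum>i\<in>I. A i z * x i) * (\<Sum>j\<in>I. A z j * x j) / A z z"
    by (simp add: S S_def[symmetric])
  also have "\<dots> = (\<Sum>i\<in>I. \<Sum>j\<in>I. A i z * A z j / A z z * x i * x j)"
    unfolding sum_product sum_divide_distrib by (simp add: mult_ac)
  finally have "quadratic_form I (schur_complement z A) x = quadratic_form I A x - S * S / A z z"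
    by (simp add: quadratic_form_def schur_complement_def left_diff_distrib sum_subtractf)
  moreover have "quadratic_form (insert z I) A x
      = A z z * x z * x z + x z * S + (x z * (\<Sum>i\<in>I. A i z * x i) + quadratic_form I A x)"
    using I by (simp add: quadratic_form_def sum.distrib S_def sum_distrib_left mult_ac)
  moreover have "A z z * (x z + S / A z z)\<^sup>2 = A z z * x z * x z + 2 * (x z * S) + S * S / A z z"
    using A by (simp add: power2_eq_square field_simps)
  ultimately show ?thesis
    unfolding S S_def[symmetric] by simp
qed

lemma positive_definite_on_sym:
  assumes "positive_definite_on I A" "i \<in> I" "j \<in> I"
  shows "A i j = A j i"
  using assms(1)[unfolded positive_definite_on_def, THEN conjunct1, rule_format, OF assms(2,3)] .

lemma positive_definite_on_pos:
  assumes "positive_definite_on I A" "i \<in> I" "x i \<noteq> 0"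
  shows "0 < quadratic_form I A x"
  by (rule assms(1)[unfolded positive_definite_on_def, THEN conjunct2, rule_format])
     (use assms(2,3) in blast)

lemma positive_definite_on_diagonal:
  assumes I: "finite I" "z \<in> I" and A: "positive_definite_on I A"
  shows "0 < A z z"
proof -
  let ?e = "\<lambda>i. if i = z then 1 else 0 :: real"
  have "0 < quadratic_form I A ?e"
    using positive_definite_on_pos[OF A I(2), of ?e] by simp
  also have "quadratic_form I A ?e = (\<Sum>i\<in>I. if i = z then \<Sum>j\<in>I. if j = z then A i j else 0 else 0)"
    unfolding quadratic_form_def by (intro sum.cong) (auto intro!: sum.neutral sum.cong)
  also have "\<dots> = A z z"
    using I by simp
  finally show ?thesis .
qed

lemma positive_definite_on_schur_complement:
  assumes I: "finite I" "z \<notin> I" and A: "positive_definite_on (insert z I) A"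
  shows "positive_definite_on I (schur_complement z A)"
  unfolding positive_definite_on_def
proof (intro conjI ballI allI impI)
  show "schur_complement z A i j = schur_complement z A j i" if "i \<in> I" "j \<in> I" for i j
    using positive_definite_on_sym[OF A, of i j] positive_definite_on_sym[OF A, of z j]
      positive_definite_on_sym[OF A, of i z] that by (simp add: schur_complement_def mult.commute)
  have pivot: "0 < A z z"
    by (rule positive_definite_on_diagonal[OF _ _ A]) (simp_all add: I)
  fix x :: "'a \<Rightarrow> real" assume "\<exists>i\<in>I. x i \<noteq> 0"
  then obtain i where i: "i \<in> I" "x i \<noteq> 0" by blast
  define y where "y = x(z := - ((\<Sum>i\<in>I. A z i * x i) / A z z))"
  have y: "y i = x i" if "i \<in> I" for i
    using that I by (auto simp: y_def)
  have "0 < quadratic_form (insert z I) A y"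
    using i y positive_definite_on_pos[OF A, of i y] by simp
  also have "\<dots> = A z z * (y z + (\<Sum>i\<in>I. A z i * y i) / A z z)\<^sup>2
      + quadratic_form I (schur_complement z A) y"
    using I pivot positive_definite_on_sym[OF A] by (intro quadratic_form_insert) auto
  also have "\<dots> = quadratic_form I (schur_complement z A) x"
    using quadratic_form_cong[of I y x] y by (simp add: y_def cong: sum.cong)
  finally show "0 < quadratic_form I (schur_complement z A) x" .
qed

lemma nn_integral_gaussian:
  assumes "a > 0"
  shows "(\<integral>\<^sup>+y. ennreal (exp (- (a * (y + c)\<^sup>2 / 2))) \<partial>lborel) = ennreal (sqrt (2 * pi / a))"
proof -
  define \<sigma> where "\<sigma> = 1 / sqrt a"
  have \<sigma>: "\<sigma> > 0" using assms by (simp add: \<sigma>_def)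
  have "ennreal (exp (- (a * (y + c)\<^sup>2 / 2)))
      = ennreal (sqrt (2 * pi / a)) * ennreal (normal_density (-c) \<sigma> y)" for y
    using assms
    by (subst ennreal_mult[symmetric])
       (simp_all add: normal_density_def \<sigma>_def power_divide field_simps)
  then have "(\<integral>\<^sup>+y. ennreal (exp (- (a * (y + c)\<^sup>2 / 2))) \<partial>lborel)
      = ennreal (sqrt (2 * pi / a)) * (\<integral>\<^sup>+y. ennreal (normal_density (-c) \<sigma> y) \<partial>lborel)"
    by (simp add: nn_integral_cmult)
  also have "(\<integral>\<^sup>+y. ennreal (normal_density (-c) \<sigma> y) \<partial>lborel) = 1"
    using integral_normal_density[OF \<sigma>] integrable_normal_density[OF \<sigma>] \<sigma>
    by (subst nn_integral_eq_integral) (auto simp: normal_density_nonneg)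
  finally show ?thesis by simp
qed

lemma gaussian_integral_insert:
  assumes I: "finite I" "z \<notin> I" and A: "positive_definite_on (insert z I) A"
  shows "gaussian_integral (insert z I) A
    = ennreal (sqrt (2 * pi / A z z)) * gaussian_integral I (schur_complement z A)"
proof -
  interpret product_sigma_finite "\<lambda>_::'a. lborel :: real measure" ..
  have pivot: "0 < A z z"
    by (rule positive_definite_on_diagonal[OF _ _ A]) (simp_all add: I)
  have sym: "A i z = A z i" if "i \<in> I" for i
    using positive_definite_on_sym[OF A] that by simp
  let ?q = "quadratic_form I (schur_complement z A)"
  have fiber: "(\<integral>\<^sup>+y. ennreal (exp (- (quadratic_form (insert z I) A (x(z := y)) / 2))) \<partial>lborel)
      = ennreal (sqrt (2 * pi / A z z)) * ennreal (exp (- (?q x / 2)))" for x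
  proof -
    define c where "c = (\<Sum>i\<in>I. A z i * x i) / A z z"
    have "quadratic_form (insert z I) A (x(z := y)) = A z z * (y + c)\<^sup>2 + ?q x" for y
    proof -
      have "(\<Sum>i\<in>I. A z i * (x(z := y)) i) = (\<Sum>i\<in>I. A z i * x i)"
        and "?q (x(z := y)) = ?q x"
        using I by (auto intro!: sum.cong quadratic_form_cong)
      then show ?thesis
        using quadratic_form_insert[where x = "x(z := y)", OF I] pivot sym by (simp add: c_def)
    qed
    then have "ennreal (exp (- (quadratic_form (insert z I) A (x(z := y)) / 2)))
        = ennreal (exp (- (A z z * (y + c)\<^sup>2 / 2))) * ennreal (exp (- (?q x / 2)))" for y
      by (simp add: ennreal_mult[symmetric] exp_add[symmetric] add_divide_distrib)
    then show ?thesis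
      by (simp add: nn_integral_multc nn_integral_gaussian[OF pivot])
  qed
  have "gaussian_integral (insert z I) A
      = (\<integral>\<^sup>+x. ennreal (sqrt (2 * pi / A z z)) * ennreal (exp (- (?q x / 2))) \<partial>PiM I (\<lambda>_. lborel))"
    unfolding gaussian_integral_def fiber[symmetric]
    by (rule product_nn_integral_insert[OF I]) measurable
  also have "\<dots> = ennreal (sqrt (2 * pi / A z z)) * gaussian_integral I (schur_complement z A)"
    unfolding gaussian_integral_def by (rule nn_integral_cmult) measurable
  finally show ?thesis .
qed

lemma gaussian_integral_det:
  assumes "distinct xs" "positive_definite_on (set xs) A"
  shows "0 < Determinant.det (matrix_on xs A)
    \<and> gaussian_integral (set xs) A
      = ennreal (sqrt ((2 * pi) ^ length xs / Determinant.det (matrix_on xs A)))"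
  using assms
proof (induction xs arbitrary: A rule: rev_induct)
  case Nil
  then show ?case
    by (simp add: matrix_on_def gaussian_integral_def quadratic_form_def PiM_empty
        nn_integral_count_space_finite)
next
  case (snoc z xs)
  then have xs: "finite (set xs)" "z \<notin> set xs" "distinct xs"
    and A: "positive_definite_on (insert z (set xs)) A"
    by simp_all
  let ?S = "schur_complement z A"
  have pivot: "0 < A z z"
    by (rule positive_definite_on_diagonal[OF _ _ A]) simp_all
  note IH = snoc.IH[OF xs(3) positive_definite_on_schur_complement[OF xs(1,2) A]]
  have det: "Determinant.det (matrix_on (xs @ [z]) A) = A z z * Determinant.det (matrix_on xs ?S)"
    using pivot by (simp add: det_matrix_on_snoc)
  have "gaussian_integral (set (xs @ [z])) A
      = ennreal (sqrt (2 * pi / A z z)) * gaussian_integral (set xs) ?S"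
    using gaussian_integral_insert[OF xs(1,2) A] by simp
  also have "\<dots>
      = ennreal (sqrt ((2 * pi) ^ length (xs @ [z]) / Determinant.det (matrix_on (xs @ [z]) A)))"
    using IH pivot by (simp add: det ennreal_mult'[symmetric] real_sqrt_mult[symmetric])
  finally show ?case
    using IH pivot by (simp add: det)
qed

lemma det_eq_if_intertwined:
  fixes M E H :: "'a::idom mat"
  assumes carrier: "M \<in> carrier_mat n n" "E \<in> carrier_mat n n" "H \<in> carrier_mat n n"
    and orthogonal: "transpose_mat H * H = 1\<^sub>m n" and intertwined: "M * H = H * E"
  shows "Determinant.det M = Determinant.det E"
proof -
  have "Determinant.det (transpose_mat H) * Determinant.det H = 1"
    using orthogonal carrier by (metis det_mult det_one transpose_carrier_mat)
  then have "Determinant.det H \<noteq> 0" by auto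
  moreover have "Determinant.det M * Determinant.det H = Determinant.det H * Determinant.det E"
    using intertwined carrier by (metis det_mult)
  ultimately show ?thesis by simp
qed

lemma matrix_on_carrier [simp]: "matrix_on xs A \<in> carrier_mat (length xs) (length xs)"
  by (simp add: matrix_on_def)

lemma matrix_on_cong:
  assumes "\<And>i j. i \<in> set xs \<Longrightarrow> j \<in> set xs \<Longrightarrow> A i j = B i j"
  shows "matrix_on xs A = matrix_on xs B"
  unfolding matrix_on_def by (intro eq_matI) (simp_all add: assms)

lemma transpose_matrix_on: "transpose_mat (matrix_on xs A) = matrix_on xs (\<lambda>i j. A j i)"
  by (intro eq_matI) (simp_all add: matrix_on_def)

lemma matrix_on_mult:
  fixes A B :: "'a \<Rightarrow> 'a \<Rightarrow> 'b::semiring_0"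
  assumes "distinct xs"
  shows "matrix_on xs A * matrix_on xs B = matrix_on xs (\<lambda>i k. \<Sum>j\<in>set xs. A i j * B j k)"
proof -
  have "(\<Sum>l<length xs. f (xs ! l)) = (\<Sum>j\<in>set xs. f j)" for f :: "'a \<Rightarrow> 'b"
    by (rule sum.reindex_bij_betw[OF bij_betw_nth[OF assms refl refl]])
  then show ?thesis
    by (intro eq_matI) (simp_all add: matrix_on_def scalar_prod_def atLeast0LessThan)
qed

lemma matrix_on_identity:
  assumes "distinct xs"
  shows "matrix_on xs (\<lambda>i j. if i = j then 1 else 0) = 1\<^sub>m (length xs)"
  using assms by (intro eq_matI) (simp_all add: matrix_on_def nth_eq_iff_index_eq)

lemma det_matrix_on_diagonal:
  fixes d :: "'a \<Rightarrow> 'b::idom"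
  assumes "distinct xs"
  shows "Determinant.det (matrix_on xs (\<lambda>i j. if i = j then d i else 0)) = (\<Prod>i\<in>set xs. d i)"
proof -
  have "Determinant.det (matrix_on xs (\<lambda>i j. if i = j then d i else 0))
      = (\<Prod>l<length xs. d (xs ! l))"
    using assms by (subst det_lower_triangular[OF _ matrix_on_carrier])
      (auto simp: matrix_on_def nth_eq_iff_index_eq prod_list_diag_prod atLeast0LessThan)
  also have "\<dots> = (\<Prod>i\<in>set xs. d i)"
    by (rule prod.reindex_bij_betw[OF bij_betw_nth[OF assms refl refl]])
  finally show ?thesis .
qed

lemma det_matrix_on_eigenbasis:
  fixes A v :: "'a \<Rightarrow> 'a \<Rightarrow> 'b::idom"
  assumes xs: "distinct xs"
    and orthonormal: "\<And>k l. k \<in> set xs \<Longrightarrow> l \<in> set xs \<Longrightarrow>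
      (\<Sum>i\<in>set xs. v k i * v l i) = (if k = l then 1 else 0)"
    and eigen: "\<And>k i. k \<in> set xs \<Longrightarrow> i \<in> set xs \<Longrightarrow> (\<Sum>j\<in>set xs. A i j * v k j) = ev k * v k i"
  shows "Determinant.det (matrix_on xs A) = (\<Prod>k\<in>set xs. ev k)"
proof -
  define H where "H = matrix_on xs (\<lambda>i k. v k i)"
  define E where "E = matrix_on xs (\<lambda>i k. if i = k then ev i else 0)"
  have "transpose_mat H * H = matrix_on xs (\<lambda>i j. if i = j then 1 else 0)"
    unfolding H_def transpose_matrix_on matrix_on_mult[OF xs]
    by (rule matrix_on_cong) (rule orthonormal)
  then have orthogonal: "transpose_mat H * H = 1\<^sub>m (length xs)"
    by (simp add: matrix_on_identity[OF xs])
  have "matrix_on xs A * H = H * E"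
    unfolding H_def E_def matrix_on_mult[OF xs]
    by (rule matrix_on_cong) (simp add: eigen if_distrib mult.commute cong: if_cong)
  then have "Determinant.det (matrix_on xs A) = Determinant.det E"
    using orthogonal by (intro det_eq_if_intertwined) (simp_all add: E_def H_def)
  then show ?thesis
    by (simp add: E_def det_matrix_on_diagonal[OF xs])
qed

lemma gaussian_integral_eigenbasis:
  fixes A v :: "'a \<Rightarrow> 'a \<Rightarrow> real"
  assumes I: "finite I" and A: "positive_definite_on I A"
    and orthonormal: "\<And>k l. k \<in> I \<Longrightarrow> l \<in> I \<Longrightarrow> (\<Sum>i\<in>I. v k i * v l i) = (if k = l then 1 else 0)"
    and eigen: "\<And>k i. k \<in> I \<Longrightarrow> i \<in> I \<Longrightarrow> (\<Sum>j\<in>I. A i j * v k j) = ev k * v k i"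
  shows "gaussian_integral I A = ennreal (sqrt (\<Prod>k\<in>I. 2 * pi / ev k))"
proof -
  obtain xs where xs: "set xs = I" "distinct xs"
    using finite_distinct_list[OF I] by auto
  have "Determinant.det (matrix_on xs A) = (\<Prod>k\<in>I. ev k)"
    using det_matrix_on_eigenbasis[OF xs(2), of v A ev] orthonormal eigen by (simp add: xs(1))
  then show ?thesis
    using gaussian_integral_det[OF xs(2), of A] A xs distinct_card[OF xs(2)]
    by (simp add: prod_dividef)
qed

subsection \<open>Periodic lattices with a mass term\<close>

definition cas :: "real \<Rightarrow> real" where
  "cas x = cos x + sin x"

definition bond_matrix :: "('a \<Rightarrow> 'a) \<Rightarrow> 'a \<Rightarrow> 'a \<Rightarrow> real" where
  "bond_matrix s r t = 2 * of_bool (r = t) - of_bool (t = s r) - of_bool (r = s t)"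

definition massive_laplacian ::
  "('d::finite \<Rightarrow> 'a \<Rightarrow> 'a) \<Rightarrow> ('d \<Rightarrow> real) \<Rightarrow> real \<Rightarrow> 'a \<Rightarrow> 'a \<Rightarrow> real" where
  "massive_laplacian s q m r t = m * of_bool (r = t) + (\<Sum>a\<in>UNIV. q a * bond_matrix (s a) r t)"

definition dirichlet_energy ::
  "('d::finite \<Rightarrow> 'a \<Rightarrow> 'a) \<Rightarrow> ('d \<Rightarrow> real) \<Rightarrow> 'a set \<Rightarrow> ('a \<Rightarrow> real) \<Rightarrow> real" where
  "dirichlet_energy s q T x = (\<Sum>r\<in>T. \<Sum>a\<in>UNIV. q a * (x r - x (s a r))\<^sup>2)"

definition massive_energy ::
  "('d::finite \<Rightarrow> 'a \<Rightarrow> 'a) \<Rightarrow> ('d \<Rightarrow> real) \<Rightarrow> real \<Rightarrow> 'a set \<Rightarrow> ('a \<Rightarrow> real) \<Rightarrow> real" where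
  "massive_energy s q m T x = dirichlet_energy s q T x + m * (\<Sum>r\<in>T. (x r)\<^sup>2)"

definition dispersion :: "('d::finite \<Rightarrow> real) \<Rightarrow> ('d \<Rightarrow> real) \<Rightarrow> real" where
  "dispersion q k = (\<Sum>a\<in>UNIV. q a * (2 - 2 * cos (k a)))"

lemma dirichlet_energy_nonneg: "(\<And>a. 0 \<le> q a) \<Longrightarrow> 0 \<le> dirichlet_energy s q T x"
  by (simp add: dirichlet_energy_def sum_nonneg)

lemma dispersion_nonneg: "(\<And>a. 0 \<le> q a) \<Longrightarrow> 0 \<le> dispersion q k"
  by (simp add: dispersion_def sum_nonneg)

lemma massive_energy_scale:
  "massive_energy s (\<lambda>a. b * q a) (b * m) T x = b * massive_energy s q m T x"
  by (simp add: massive_energy_def dirichlet_energy_def sum_distrib_left distrib_left mult.assoc)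

lemma dispersion_scale: "dispersion (\<lambda>a. b * q a) k = b * dispersion q k"
  by (simp add: dispersion_def sum_distrib_left mult.assoc)

lemma cas_rcong:
  assumes "[x = y] (rmod (2 * pi))"
  shows "cas x = cas y"
  using assms unfolding cas_def rcong_def by (metis sin_rmod cos_rmod)

lemma quadratic_form_bond_matrix:
  assumes T: "finite T" and s: "bij_betw s T T"
  shows "quadratic_form T (bond_matrix s) x = (\<Sum>r\<in>T. (x r - x (s r))\<^sup>2)"
proof -
  have s_mem: "s r \<in> T" if "r \<in> T" for r
    using s that by (auto simp: bij_betw_def)
  have diagonal: "(\<Sum>r\<in>T. \<Sum>t\<in>T. of_bool (r = t) * x r * x t) = (\<Sum>r\<in>T. (x r)\<^sup>2)"
    using T by (intro sum.cong)
       (simp_all add: of_bool_def if_distrib if_distribR power2_eq_square cong: if_cong)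
  have forward: "(\<Sum>r\<in>T. \<Sum>t\<in>T. of_bool (t = s r) * x r * x t) = (\<Sum>r\<in>T. x r * x (s r))"
    using T s_mem by (intro sum.cong)
       (simp_all add: of_bool_def if_distrib if_distribR cong: if_cong)
  have backward: "(\<Sum>r\<in>T. \<Sum>t\<in>T. of_bool (r = s t) * x r * x t) = (\<Sum>r\<in>T. x r * x (s r))"
    by (subst sum.swap) (simp add: forward[symmetric] mult_ac)
  have "quadratic_form T (bond_matrix s) x = 2 * (\<Sum>r\<in>T. (x r)\<^sup>2) - 2 * (\<Sum>r\<in>T. x r * x (s r))"
    using diagonal forward backward
    by (simp add: quadratic_form_def bond_matrix_def left_diff_distrib sum_subtractf mult.assoc
        flip: sum_distrib_left)
  also have "\<dots> = (\<Sum>r\<in>T. (x r)\<^sup>2) + (\<Sum>r\<in>T. (x (s r))\<^sup>2) - 2 * (\<Sum>r\<in>T. x r * x (s r))"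
    using sum.reindex_bij_betw[OF s, of "\<lambda>r. (x r)\<^sup>2"] by simp
  also have "\<dots> = (\<Sum>r\<in>T. (x r - x (s r))\<^sup>2)"
    by (simp add: power2_diff sum.distrib sum_subtractf sum_distrib_left mult_ac)
  finally show ?thesis .
qed

lemma bond_matrix_cas:
  assumes T: "finite T" and s: "bij_betw s T T" and r: "r \<in> T"
    and phase: "\<And>t. t \<in> T \<Longrightarrow> [p (s t) = p t + k] (rmod (2 * pi))"
  shows "(\<Sum>t\<in>T. bond_matrix s r t * cas (p t)) = (2 - 2 * cos k) * cas (p r)"
proof -
  obtain u where u: "u \<in> T" "r = s u"
    using s r by (auto simp: bij_betw_def)
  have pre: "r = s t \<longleftrightarrow> t = u" if "t \<in> T" for t
    using s u that by (auto simp: bij_betw_def inj_on_def)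
  have sr: "s r \<in> T"
    using s r by (auto simp: bij_betw_def)
  have forward: "cas (p (s r)) = cas (p r + k)"
    using phase[OF r] by (rule cas_rcong)
  have "[p r - k = p u + k - k] (rmod (2 * pi))"
    using phase[OF u(1)] u(2) by (intro rcong_intros) simp_all
  then have backward: "cas (p u) = cas (p r - k)"
    by (simp add: cas_rcong)
  have "(\<Sum>t\<in>T. bond_matrix s r t * cas (p t))
      = (\<Sum>t\<in>T. (if r = t then 2 * cas (p t) else 0) - (if t = s r then cas (p t) else 0)
         - (if t = u then cas (p t) else 0))"
    by (intro sum.cong) (auto simp: bond_matrix_def pre algebra_simps)
  also have "\<dots> = 2 * cas (p r) - cas (p (s r)) - cas (p u)"
    using T r sr u by (simp add: sum_subtractf)
  also have "\<dots> = (2 - 2 * cos k) * cas (p r)"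
    unfolding forward backward
    by (simp add: cas_def cos_add sin_add cos_diff sin_diff algebra_simps)
  finally show ?thesis .
qed

lemma quadratic_form_massive_laplacian:
  assumes T: "finite T" and s: "\<And>a. bij_betw (s a) T T"
  shows "quadratic_form T (massive_laplacian s q m) x = massive_energy s q m T x"
proof -
  have mass: "(\<Sum>r\<in>T. \<Sum>t\<in>T. of_bool (r = t) * x r * x t) = (\<Sum>r\<in>T. (x r)\<^sup>2)"
    using T by (intro sum.cong)
       (simp_all add: of_bool_def if_distrib if_distribR power2_eq_square cong: if_cong)
  have "quadratic_form T (massive_laplacian s q m) x
      = m * (\<Sum>r\<in>T. \<Sum>t\<in>T. of_bool (r = t) * x r * x t)
        + (\<Sum>r\<in>T. \<Sum>t\<in>T. \<Sum>a\<in>UNIV. q a * (bond_matrix (s a) r t * x r * x t))"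
    by (simp add: quadratic_form_def massive_laplacian_def distrib_right sum.distrib
        sum_distrib_left sum_distrib_right mult.assoc)
  also have "(\<Sum>r\<in>T. \<Sum>t\<in>T. \<Sum>a\<in>UNIV. q a * (bond_matrix (s a) r t * x r * x t))
      = (\<Sum>a\<in>UNIV. q a * quadratic_form T (bond_matrix (s a)) x)"
    by (subst sum.swap[of _ UNIV], subst sum.swap[of _ UNIV])
       (simp add: quadratic_form_def sum_distrib_left)
  also have "\<dots> = dirichlet_energy s q T x"
    unfolding dirichlet_energy_def
    by (subst sum.swap) (simp add: quadratic_form_bond_matrix[OF T s] sum_distrib_left)
  finally show ?thesis
    by (simp add: mass massive_energy_def)
qed

lemma massive_laplacian_cas:
  assumes T: "finite T" and s: "\<And>a. bij_betw (s a) T T" and r: "r \<in> T"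
    and phase: "\<And>a t. t \<in> T \<Longrightarrow> [p (s a t) = p t + k a] (rmod (2 * pi))"
  shows "(\<Sum>t\<in>T. massive_laplacian s q m r t * cas (p t)) = (dispersion q k + m) * cas (p r)"
proof -
  have mass: "(\<Sum>t\<in>T. of_bool (r = t) * cas (p t)) = cas (p r)"
    using T r by (simp add: of_bool_def if_distrib if_distribR cong: if_cong)
  have bonds: "(\<Sum>t\<in>T. bond_matrix (s a) r t * cas (p t)) = (2 - 2 * cos (k a)) * cas (p r)" for a
    by (rule bond_matrix_cas[OF T s r]) (rule phase)
  have "(\<Sum>t\<in>T. massive_laplacian s q m r t * cas (p t))
      = m * (\<Sum>t\<in>T. of_bool (r = t) * cas (p t))
        + (\<Sum>a\<in>UNIV. q a * (\<Sum>t\<in>T. bond_matrix (s a) r t * cas (p t)))"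
    by (subst (2) sum_distrib_left, subst sum.swap)
       (simp add: massive_laplacian_def distrib_right sum.distrib
         sum_distrib_left sum_distrib_right mult.assoc)
  also have "\<dots> = (dispersion q k + m) * cas (p r)"
    unfolding mass bonds dispersion_def by (simp add: sum_distrib_right distrib_right mult.assoc)
  finally show ?thesis .
qed

lemma positive_definite_massive_laplacian:
  assumes T: "finite T" and s: "\<And>a. bij_betw (s a) T T" and q: "\<And>a. 0 \<le> q a" and m: "0 < m"
  shows "positive_definite_on T (massive_laplacian s q m)"
  unfolding positive_definite_on_def
proof (intro conjI ballI allI impI)
  fix r t
  have "bond_matrix (s a) r t = bond_matrix (s a) t r" for a
    by (auto simp: bond_matrix_def)
  then show "massive_laplacian s q m r t = massive_laplacian s q m t r"
    by (simp add: massive_laplacian_def eq_commute[of r t])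
next
  fix x :: "_ \<Rightarrow> real" assume "\<exists>r\<in>T. x r \<noteq> 0"
  then have "0 < (\<Sum>r\<in>T. (x r)\<^sup>2)"
    using T by (auto intro: sum_pos2)
  then show "0 < quadratic_form T (massive_laplacian s q m) x"
    unfolding quadratic_form_massive_laplacian[OF T s] massive_energy_def
    using m dirichlet_energy_nonneg[of q s T x] q by (simp add: add_nonneg_pos)
qed

lemma nn_integral_exp_massive_energy:
  fixes p :: "'a \<Rightarrow> 'a \<Rightarrow> real" and k :: "'a \<Rightarrow> 'd::finite \<Rightarrow> real"
  assumes T: "finite T" and s: "\<And>a. bij_betw (s a) T T" and q: "\<And>a. 0 \<le> q a" and m: "0 < m"
    and phase: "\<And>j a t. j \<in> T \<Longrightarrow> t \<in> T \<Longrightarrow> [p j (s a t) = p j t + k j a] (rmod (2 * pi))"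
    and orthonormal: "\<And>i j. i \<in> T \<Longrightarrow> j \<in> T \<Longrightarrow>
      (\<Sum>t\<in>T. (cas (p i t) / c) * (cas (p j t) / c)) = (if i = j then 1 else 0)"
  shows "(\<integral>\<^sup>+x. ennreal (exp (- (massive_energy s q m T x / 2))) \<partial>PiM T (\<lambda>_. lborel))
    = ennreal (sqrt (\<Prod>j\<in>T. 2 * pi / (dispersion q (k j) + m)))"
proof -
  have "(\<Sum>t\<in>T. massive_laplacian s q m r t * (cas (p j t) / c))
      = (dispersion q (k j) + m) * (cas (p j r) / c)" if "j \<in> T" "r \<in> T" for j r
    using massive_laplacian_cas[where p = "p j" and k = "k j", OF T s that(2) phase[OF that(1)]]
    by (simp flip: sum_divide_distrib)
  then have "gaussian_integral T (massive_laplacian s q m)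
      = ennreal (sqrt (\<Prod>j\<in>T. 2 * pi / (dispersion q (k j) + m)))"
    by (intro gaussian_integral_eigenbasis[OF T _ orthonormal]
        positive_definite_massive_laplacian[OF T s q m])
  then show ?thesis
    by (simp add: gaussian_integral_def quadratic_form_massive_laplacian[OF T s])
qed

subsection \<open>The Hartley basis of the torus\<close>

definition coord :: "'a \<times> 'a \<times> 'a \<Rightarrow> 3 \<Rightarrow> 'a" where
  "coord x a = (if a = 1 then fst x else if a = 2 then fst (snd x) else snd (snd x))"

definition map_coords :: "('a \<Rightarrow> 'b) \<Rightarrow> 'a \<times> 'a \<times> 'a \<Rightarrow> 'b \<times> 'b \<times> 'b" where
  "map_coords f = map_prod f (map_prod f f)"

definition shift :: "nat \<Rightarrow> 3 \<Rightarrow> nat \<times> nat \<times> nat \<Rightarrow> nat \<times> nat \<times> nat" where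
  "shift L a = (if a = 1 then shift1 L else if a = 2 then shift2 L else shift3 L)"

lemma coord_map_coords [simp]: "coord (map_coords f x) a = f (coord x a)"
  by (simp add: coord_def map_coords_def)

lemma coord_eq_iff: "x = y \<longleftrightarrow> (\<forall>a. coord x a = coord y a)"
  by (auto simp: coord_def forall_3 prod_eq_iff)

lemma coord_shift: "coord (shift L a x) b = (if b = a then Suc (coord x a) mod L else coord x b)"
proof -
  have "\<forall>a b. coord (shift L a x) b = (if b = a then Suc (coord x a) mod L else coord x b)"
    unfolding forall_3
    by (simp add: coord_def shift_def shift1_def shift2_def shift3_def split: prod.split)
  then show ?thesis by blast
qed

lemma finite_torus [simp]: "finite (torus L)"
  by (simp add: torus_def)

lemma card_torus: "card (torus L) = L ^ 3"
  by (simp add: torus_def power3_eq_cube)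

lemma mem_torus_iff: "x \<in> torus L \<longleftrightarrow> (\<forall>a. coord x a < L)"
  by (cases x) (simp add: torus_def coord_def forall_3)

lemma torus_imp_pos: "x \<in> torus L \<Longrightarrow> 0 < L"
  by (cases "L = 0") (simp_all add: torus_def)

lemma bij_betw_shift: "bij_betw (shift L a) (torus L) (torus L)"
proof -
  have inj_Suc_mod: "inj_on (\<lambda>i. Suc i mod L) {..<L}"
    by (auto simp: inj_on_def mod_Suc split: if_splits)
  have "inj_on (shift L a) (torus L)"
  proof (rule inj_onI)
    fix x y assume mem: "x \<in> torus L" "y \<in> torus L" and "shift L a x = shift L a y"
    then have shifted: "coord (shift L a x) b = coord (shift L a y) b" for b by simp
    have "coord x b = coord y b" for b
      using mem inj_onD[OF inj_Suc_mod, of "coord x a" "coord y a"] shifted[of b]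
      by (cases "b = a") (simp_all add: coord_shift mem_torus_iff)
    then show "x = y" by (simp add: coord_eq_iff)
  qed
  moreover have "shift L a x \<in> torus L" if "x \<in> torus L" for x
    using that torus_imp_pos[OF that] by (simp add: mem_torus_iff coord_shift)
  ultimately show ?thesis
    by (simp add: bij_betw_def endo_inj_surj image_subsetI)
qed

lemma shift_in_torus: "r \<in> torus L \<Longrightarrow> shift L a r \<in> torus L"
  using bij_betw_shift by (rule bij_betw_apply)

lemma prod_3: "prod f (UNIV :: 3 set) = f 1 * f 2 * f 3"
  unfolding UNIV_3 by (simp add: ac_simps)

lemma sum_torus_prod:
  fixes f :: "3 \<Rightarrow> nat \<Rightarrow> 'a::comm_semiring_1"
  shows "(\<Sum>x\<in>torus L. \<Prod>a\<in>UNIV. f a (coord x a)) = (\<Prod>a\<in>UNIV. \<Sum>i<L. f a i)"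
proof -
  have "(\<Sum>x\<in>torus L. \<Prod>a\<in>UNIV. f a (coord x a))
      = (\<Sum>x\<in>torus L. f 1 (fst x) * (f 2 (fst (snd x)) * f 3 (snd (snd x))))"
    by (simp add: coord_def prod_3 mult.assoc)
  also have "\<dots> = (\<Sum>i<L. f 1 i) * ((\<Sum>i<L. f 2 i) * (\<Sum>i<L. f 3 i))"
    by (simp add: torus_def sum.cartesian_product' atLeast0LessThan
        flip: sum_distrib_left sum_distrib_right)
  finally show ?thesis
    by (simp add: prod_3 mult.assoc)
qed

lemma cis_sum: "cis (sum f A) = (\<Prod>a\<in>A. cis (f a))"
  by (induction A rule: infinite_finite_induct) (simp_all flip: cis_mult)

lemma sum_cis_period:
  fixes m :: int
  assumes L: "L > 0"
  shows "(\<Sum>x<L. cis (2 * pi * of_int m / real L * real x)) = (if int L dvd m then of_nat L else 0)"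
proof -
  define w where "w = cis (2 * pi * of_int m / real L)"
  have "cis (2 * pi * of_int m / real L * real x) = w ^ x" for x
    by (simp only: w_def Complex.DeMoivre mult.commute[of _ "real x"])
  moreover have "w ^ L = 1"
    using L cis_multiple_2pi[of "of_int m"] by (simp add: w_def Complex.DeMoivre)
  moreover have "w = 1 \<longleftrightarrow> int L dvd m"
  proof -
    have "w = 1 \<longleftrightarrow> (\<exists>n::int. real_of_int m = of_int (n * int L))"
      using cis_eq_iff[of 0 "2 * pi * of_int m / real L"] L
      by (auto simp: w_def rcong_altdef field_simps)
    then show ?thesis
      unfolding of_int_eq_iff by (auto simp: dvd_def mult.commute)
  qed
  ultimately show ?thesis
    by (simp add: sum_gp_strict)
qed

text \<open>The labels are centred so that the momenta lie in \<open>[-\<pi>, \<pi>)\<close>, matching the domain of integration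
  of the spin-wave free energy.\<close>
definition momentum :: "nat \<Rightarrow> nat \<Rightarrow> real" where
  "momentum L i = 2 * pi * of_int (int i - int (L div 2)) / real L"

definition torus_momentum :: "nat \<Rightarrow> nat \<times> nat \<times> nat \<Rightarrow> real \<times> real \<times> real" where
  "torus_momentum L = map_coords (momentum L)"

definition torus_phase :: "nat \<Rightarrow> nat \<times> nat \<times> nat \<Rightarrow> nat \<times> nat \<times> nat \<Rightarrow> real" where
  "torus_phase L j x = (\<Sum>a\<in>UNIV. momentum L (coord j a) * real (coord x a))"

lemma momentum_Suc_mod:
  assumes "n < L"
  shows "[momentum L i * real (Suc n mod L) = momentum L i * real n + momentum L i] (rmod (2 * pi))"
proof (cases "Suc n = L")
  case True
  have "momentum L i * real n + momentum L i = momentum L i * real L"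
    using True by (simp add: algebra_simps flip: True)
  also have "\<dots> = of_int (int i - int (L div 2)) * (2 * pi)"
    using assms by (simp add: momentum_def)
  finally show ?thesis
    using True unfolding rcong_altdef by (intro exI[of _ "int i - int (L div 2)"]) simp
next
  case False
  then show ?thesis
    using assms by (simp add: algebra_simps)
qed

lemma torus_phase_shift:
  assumes "x \<in> torus L"
  shows "[torus_phase L j (shift L a x) = torus_phase L j x
      + momentum L (coord j a)] (rmod (2 * pi))"
proof -
  define rest where "rest = (\<Sum>b\<in>UNIV - {a}. momentum L (coord j b) * real (coord x b))"
  have shifted: "torus_phase L j (shift L a x)
      = momentum L (coord j a) * real (Suc (coord x a) mod L) + rest"
    unfolding torus_phase_def rest_def by (subst sum.remove[of _ a])
       (auto simp: coord_shift intro!: sum.cong)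
  have translated: "torus_phase L j x + momentum L (coord j a)
      = momentum L (coord j a) * real (coord x a) + momentum L (coord j a) + rest"
    unfolding torus_phase_def rest_def by (subst sum.remove[of _ a]) auto
  show ?thesis
    unfolding shifted translated rcong_add_right_cancel
    using assms by (intro momentum_Suc_mod) (simp add: mem_torus_iff)
qed

lemma cas_mult: "cas x * cas y = cos (x - y) + sin (x + y)"
  by (simp add: cas_def cos_diff sin_add algebra_simps)

lemma sum_torus_cis:
  fixes m :: "3 \<Rightarrow> int"
  assumes "L > 0"
  shows "(\<Sum>x\<in>torus L. cis (\<Sum>a\<in>UNIV. 2 * pi * of_int (m a) / real L * real (coord x a)))
    = (if \<forall>a. int L dvd m a then of_nat (L ^ 3) else 0)"
proof -
  have "(\<Sum>x\<in>torus L. cis (\<Sum>a\<in>UNIV. 2 * pi * of_int (m a) / real L * real (coord x a)))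
      = (\<Prod>a\<in>UNIV. if int L dvd m a then of_nat L else 0)"
    unfolding cis_sum
    using sum_torus_prod[where L = L and f = "\<lambda>a n. cis (2 * pi * of_int (m a) / real L * real n)"]
    by (simp only: sum_cis_period[OF assms])
  then show ?thesis
    by (auto simp: prod_3 forall_3 power3_eq_cube)
qed

definition hartley :: "nat \<Rightarrow> nat \<times> nat \<times> nat \<Rightarrow> nat \<times> nat \<times> nat \<Rightarrow> real" where
  "hartley L j x = cas (torus_phase L j x) / sqrt (real L ^ 3)"

lemma hartley_orthonormal:
  assumes L: "L > 0" and ij: "i \<in> torus L" "j \<in> torus L"
  shows "(\<Sum>x\<in>torus L. hartley L i x * hartley L j x) = (if i = j then 1 else 0)"
proof -
  define wave where "wave = (\<lambda>m x. \<Sum>a\<in>UNIV. 2 * pi * of_int (m a) / real L * real (coord x a))"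
  define d where "d = (\<lambda>a. int (coord i a) - int (coord j a))"
  define s where "s = (\<lambda>a. int (coord i a) + int (coord j a) - 2 * int (L div 2))"
  have difference: "torus_phase L i x - torus_phase L j x = wave d x"
    and sum: "torus_phase L i x + torus_phase L j x = wave s x" for x
    unfolding torus_phase_def wave_def sum_subtractf[symmetric] sum.distrib[symmetric]
    using L by (auto intro!: sum.cong simp: momentum_def d_def s_def field_simps)
  have "hartley L i x * hartley L j x = (Re (cis (wave d x)) + Im (cis (wave s x))) / real L ^ 3"
    for x
    using cas_mult[of "torus_phase L i x" "torus_phase L j x"]
    by (simp add: hartley_def difference sum)
  then have "(\<Sum>x\<in>torus L. hartley L i x * hartley L j x)
      = (Re (\<Sum>x\<in>torus L. cis (wave d x)) + Im (\<Sum>x\<in>torus L. cis (wave s x))) / real L ^ 3"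
    using L by (simp add: sum.distrib flip: sum_divide_distrib)
  also have "Im (\<Sum>x\<in>torus L. cis (wave s x)) = 0"
    unfolding wave_def sum_torus_cis[OF L] by simp
  also have "(\<Sum>x\<in>torus L. cis (wave d x)) = (if i = j then of_nat (L ^ 3) else 0)"
  proof -
    have "int L dvd int m - int n \<longleftrightarrow> m = n" if "m < L" "n < L" for m n
      using zdvd_not_zless[of "int m - int n" "int L"]
        zdvd_not_zless[of "int n - int m" "int L"] that
      by (cases m n rule: linorder_cases) (auto simp: dvd_diff_commute)
    then have "(\<forall>a. int L dvd d a) \<longleftrightarrow> i = j"
      using ij by (simp add: d_def mem_torus_iff coord_eq_iff)
    then show ?thesis
      unfolding wave_def sum_torus_cis[OF L] by simp
  qed
  finally show ?thesis
    using L by simp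
qed

definition mean_log_dispersion :: "(3 \<Rightarrow> real) \<Rightarrow> real \<Rightarrow> nat \<Rightarrow> real" where
  "mean_log_dispersion q m L =
    (\<Sum>j\<in>torus L. ln (dispersion q (coord (torus_momentum L j)) + m)) / real L ^ 3"

definition gaussian_free_energy :: "(3 \<Rightarrow> real) \<Rightarrow> real \<Rightarrow> real \<Rightarrow> nat \<Rightarrow> real" where
  "gaussian_free_energy q b m L = (ln (b / (2 * pi)) + mean_log_dispersion q m L) / 2"

lemma nn_integral_torus_gaussian:
  assumes L: "L > 0" and b: "b > 0" and m: "m > 0" and q: "\<And>a. 0 \<le> q a"
  shows "(\<integral>\<^sup>+x. ennreal (exp (- (b / 2 * massive_energy (shift L) q m (torus L) x)))
      \<partial>PiM (torus L) (\<lambda>_. lborel))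
    = ennreal (exp (- (real L ^ 3 * gaussian_free_energy q b m L)))"
proof -
  define D where "D = (\<lambda>j. dispersion q (coord (torus_momentum L j)) + m)"
  have D: "D j > 0" for j
    using dispersion_nonneg[of q] q m by (simp add: D_def add_nonneg_pos)
  have coords: "coord (torus_momentum L j) = (\<lambda>a. momentum L (coord j a))" for j
    by (simp add: torus_momentum_def fun_eq_iff)
  have "0 < (\<Prod>j\<in>torus L. 2 * pi / (b * D j))"
    using D b by (simp add: prod_pos)
  then have "sqrt (\<Prod>j\<in>torus L. 2 * pi / (b * D j)) = exp (ln (\<Prod>j\<in>torus L. 2 * pi / (b * D j)) / 2)"
    using exp_ln[of "sqrt (\<Prod>j\<in>torus L. 2 * pi / (b * D j))"] by (simp add: ln_sqrt)
  also have "ln (\<Prod>j\<in>torus L. 2 * pi / (b * D j)) = (\<Sum>j\<in>torus L. - (ln (b / (2 * pi)) + ln (D j)))"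
    using D b by (subst ln_prod)
       (auto simp: ln_div ln_mult less_imp_neq[THEN not_sym] intro!: sum.cong)
  also have "\<dots> = - (real L ^ 3 * (ln (b / (2 * pi)) + mean_log_dispersion q m L))"
    using L by (simp add: sum_negf sum.distrib sum_subtractf card_torus
      mean_log_dispersion_def D_def distrib_left)
  finally have product: "sqrt (\<Prod>j\<in>torus L. 2 * pi / (b * D j))
      = exp (- (real L ^ 3 * gaussian_free_energy q b m L))"
    by (simp add: gaussian_free_energy_def)
  have "(\<integral>\<^sup>+x. ennreal (exp (- (b / 2 * massive_energy (shift L) q m (torus L) x)))
      \<partial>PiM (torus L) (\<lambda>_. lborel))
      = (\<integral>\<^sup>+x. ennreal (exp (- (massive_energy (shift L) (\<lambda>a. b * q a) (b * m) (torus L) x / 2)))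
          \<partial>PiM (torus L) (\<lambda>_. lborel))"
    by (simp add: massive_energy_scale)
  also have "\<dots> = ennreal (sqrt (\<Prod>j\<in>torus L. 2 * pi / (b * D j)))"
    using nn_integral_exp_massive_energy[OF finite_torus bij_betw_shift _ _ torus_phase_shift
        hartley_orthonormal[OF L, unfolded hartley_def], of "\<lambda>a. b * q a" "b * m"] b m q
    by (simp add: dispersion_scale D_def coords distrib_left)
  finally show ?thesis
    unfolding product .
qed

subsection \<open>Substitution in product integrals\<close>

lemma prod_indicator_eq_indicator_PiE:
  assumes "finite I" "x \<in> extensional I"
  shows "(\<Prod>i\<in>I. indicator (A i) (x i))
      = (indicator (PiE I A) x :: 'b::{comm_semiring_1,semiring_no_zero_divisors})"
proof (cases "\<exists>i\<in>I. x i \<notin> A i")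
  case True
  then have "(\<Prod>i\<in>I. indicator (A i) (x i)) = (0 :: 'b)"
    using assms by (intro prod_zero) (auto simp: indicator_def)
  then show ?thesis
    using True by (auto simp: PiE_def indicator_def)
qed (use assms in \<open>auto simp: PiE_def\<close>)

lemma density_PiM:
  fixes f :: "'i \<Rightarrow> 'a \<Rightarrow> ennreal"
  assumes I: "finite I" and M: "\<And>i. sigma_finite_measure (M i)"
    and f [measurable]: "\<And>i. f i \<in> borel_measurable (M i)" and finite: "\<And>i y. f i y \<noteq> \<infinity>"
  shows "density (PiM I M) (\<lambda>x. \<Prod>i\<in>I. f i (x i)) = PiM I (\<lambda>i. density (M i) (f i))"
proof -
  interpret M: product_sigma_finite M
    by (rule product_sigma_finite.intro) (rule M)
  interpret D: product_sigma_finite "\<lambda>i. density (M i) (f i)"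
    by (rule product_sigma_finite.intro)
       (use finite in \<open>simp add: sigma_finite_measure.sigma_finite_iff_density_finite[OF M f]\<close>)
  show ?thesis
  proof (rule D.PiM_eqI[OF I])
    show "sets (density (PiM I M) (\<lambda>x. \<Prod>i\<in>I. f i (x i))) = sets (PiM I (\<lambda>i. density (M i) (f i)))"
      by (simp cong: sets_PiM_cong)
    fix A assume "\<And>i. i \<in> I \<Longrightarrow> A i \<in> sets (density (M i) (f i))"
    then have A: "A i \<in> sets (M i)" if "i \<in> I" for i
      using that by simp
    have "emeasure (density (PiM I M) (\<lambda>x. \<Prod>i\<in>I. f i (x i))) (PiE I A)
        = (\<integral>\<^sup>+x. (\<Prod>i\<in>I. f i (x i)) * indicator (PiE I A) x \<partial>PiM I M)"
      using A I by (intro emeasure_density) (auto intro!: sets_PiM_I_finite)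
    also have "\<dots> = (\<integral>\<^sup>+x. (\<Prod>i\<in>I. f i (x i) * indicator (A i) (x i)) \<partial>PiM I M)"
      using I by (intro nn_integral_cong)
        (simp add: space_PiM PiE_iff prod.distrib prod_indicator_eq_indicator_PiE)
    also have "\<dots> = (\<Prod>i\<in>I. \<integral>\<^sup>+y. f i y * indicator (A i) y \<partial>M i)"
      using A by (intro M.product_nn_integral_prod[OF I]) auto
    also have "\<dots> = (\<Prod>i\<in>I. emeasure (density (M i) (f i)) (A i))"
      using A by (intro prod.cong) (simp_all add: emeasure_density)
    finally show "emeasure (density (PiM I M) (\<lambda>x. \<Prod>i\<in>I. f i (x i))) (PiE I A)
        = (\<Prod>i\<in>I. emeasure (density (M i) (f i)) (A i))" .
  qed
qed

lemma distr_PiM: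
  assumes I: "finite I" and N: "\<And>i. sigma_finite_measure (N i)"
    and g [measurable]: "\<And>i. g i \<in> measurable (N i) (M i)"
    and distr: "\<And>i. sigma_finite_measure (distr (N i) (M i) (g i))"
  shows "distr (PiM I N) (PiM I M) (\<lambda>x. \<lambda>i\<in>I. g i (x i)) = PiM I (\<lambda>i. distr (N i) (M i) (g i))"
proof -
  interpret N: product_sigma_finite N
    by (rule product_sigma_finite.intro) (rule N)
  interpret D: product_sigma_finite "\<lambda>i. distr (N i) (M i) (g i)"
    by (rule product_sigma_finite.intro) (rule distr)
  let ?G = "\<lambda>x. \<lambda>i\<in>I. g i (x i)"
  show ?thesis
  proof (rule D.PiM_eqI[OF I])
    show "sets (distr (PiM I N) (PiM I M) ?G) = sets (PiM I (\<lambda>i. distr (N i) (M i) (g i)))"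
      by (simp cong: sets_PiM_cong)
    fix A assume "\<And>i. i \<in> I \<Longrightarrow> A i \<in> sets (distr (N i) (M i) (g i))"
    then have A: "A i \<in> sets (M i)" if "i \<in> I" for i
      using that by simp
    have "emeasure (distr (PiM I N) (PiM I M) ?G) (PiE I A)
        = emeasure (PiM I N) (?G -` PiE I A \<inter> space (PiM I N))"
      using A I by (intro emeasure_distr) (auto intro!: sets_PiM_I_finite)
    also have "?G -` PiE I A \<inter> space (PiM I N) = PiE I (\<lambda>i. g i -` A i \<inter> space (N i))"
      by (auto simp: space_PiM PiE_iff)
    also have "emeasure (PiM I N) \<dots> = (\<Prod>i\<in>I. emeasure (N i) (g i -` A i \<inter> space (N i)))"
      using A by (intro N.emeasure_PiM[OF I]) (auto intro: measurable_sets[OF g])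
    also have "\<dots> = (\<Prod>i\<in>I. emeasure (distr (N i) (M i) (g i)) (A i))"
      using A by (intro prod.cong) (simp_all add: emeasure_distr)
    finally show "emeasure (distr (PiM I N) (PiM I M) ?G) (PiE I A)
        = (\<Prod>i\<in>I. emeasure (distr (N i) (M i) (g i)) (A i))" .
  qed
qed

lemma nn_integral_PiM_substitution:
  fixes v :: "'a \<Rightarrow> ennreal" and w :: "'b \<Rightarrow> ennreal"
  assumes I: "finite I" and M: "sigma_finite_measure M" and N: "sigma_finite_measure N"
    and v [measurable]: "v \<in> borel_measurable M" "\<And>y. v y \<noteq> \<infinity>"
    and w [measurable]: "w \<in> borel_measurable N" "\<And>x. w x \<noteq> \<infinity>"
    and g [measurable]: "g \<in> measurable N M"
    and substitution: "density M v = distr (density N w) M g"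
    and F [measurable]: "F \<in> borel_measurable (PiM I (\<lambda>_. M))"
  shows "(\<integral>\<^sup>+y. (\<Prod>i\<in>I. v (y i)) * F y \<partial>PiM I (\<lambda>_. M))
       = (\<integral>\<^sup>+x. (\<Prod>i\<in>I. w (x i)) * F (\<lambda>i\<in>I. g (x i)) \<partial>PiM I (\<lambda>_. N))"
proof -
  have sigma_finite: "sigma_finite_measure (density M v)" "sigma_finite_measure (density N w)"
    using v w by (simp_all add: sigma_finite_measure.sigma_finite_iff_density_finite[OF M]
        sigma_finite_measure.sigma_finite_iff_density_finite[OF N])
  have "(\<integral>\<^sup>+y. (\<Prod>i\<in>I. v (y i)) * F y \<partial>PiM I (\<lambda>_. M)) = integral\<^sup>N (PiM I (\<lambda>_. density M v)) F"
    by (subst density_PiM[OF I M v, symmetric]) (simp add: nn_integral_density)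
  also have "PiM I (\<lambda>_. density M v)
      = distr (PiM I (\<lambda>_. density N w)) (PiM I (\<lambda>_. M)) (\<lambda>x. \<lambda>i\<in>I. g (x i))"
    unfolding substitution using sigma_finite
    by (intro distr_PiM[symmetric] I) (simp_all flip: substitution)
  also have "integral\<^sup>N \<dots> F = (\<integral>\<^sup>+x. F (\<lambda>i\<in>I. g (x i)) \<partial>PiM I (\<lambda>_. density N w))"
    by (rule nn_integral_distr) simp_all
  also have "\<dots> = (\<integral>\<^sup>+x. (\<Prod>i\<in>I. w (x i)) * F (\<lambda>i\<in>I. g (x i)) \<partial>PiM I (\<lambda>_. N))"
    by (subst density_PiM[OF I N w, symmetric]) (simp add: nn_integral_density)
  finally show ?thesis .
qed

lemma nn_integral_lborel_translate:
  fixes f :: "real \<Rightarrow> ennreal"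
  assumes "f \<in> borel_measurable borel"
  shows "(\<integral>\<^sup>+x. f (t + x) \<partial>lborel) = (\<integral>\<^sup>+x. f x \<partial>lborel)"
  using nn_integral_real_affine[OF assms, of 1 t] by simp

lemma nn_integral_indicator_tiling:
  fixes p x :: real
  assumes "p > 0"
  shows "(\<integral>\<^sup>+n. indicator {of_int n * p..<of_int n * p + p} x \<partial>count_space (UNIV :: int set)) = 1"
proof -
  have "x \<in> {of_int n * p..<of_int n * p + p} \<longleftrightarrow> n = \<lfloor>x / p\<rfloor>" for n
    using assms unfolding eq_commute[of n] floor_eq_iff
    by (auto simp: le_divide_eq divide_less_eq algebra_simps)
  then have "indicator {of_int n * p..<of_int n * p + p} x = (indicator {\<lfloor>x / p\<rfloor>} n :: ennreal)"
    for n
    by (simp add: indicator_def)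
  then show ?thesis by simp
qed

lemma nn_integral_periodization:
  fixes f :: "real \<Rightarrow> ennreal"
  assumes p: "p > 0" and f [measurable]: "f \<in> borel_measurable borel"
  shows "(\<integral>\<^sup>+x. f x \<partial>lborel)
    = (\<integral>\<^sup>+y\<in>{0..<p}. (\<integral>\<^sup>+n. f (y + of_int n * p) \<partial>count_space UNIV) \<partial>lborel)"
proof -
  interpret lattice: sigma_finite_measure "count_space (UNIV :: int set)"
    by (rule sigma_finite_measure_count_space)
  interpret pair_sigma_finite lborel "count_space (UNIV :: int set)" ..
  define cell where "cell = (\<lambda>n::int. {of_int n * p..<of_int n * p + p})"
  have "f x = (\<integral>\<^sup>+n. f x * indicator (cell n) x \<partial>count_space UNIV)" for x
    using nn_integral_indicator_tiling[OF p] by (simp add: cell_def nn_integral_cmult)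
  then have "(\<integral>\<^sup>+x. f x \<partial>lborel)
      = (\<integral>\<^sup>+x. (\<integral>\<^sup>+n. f x * indicator (cell n) x \<partial>count_space UNIV) \<partial>lborel)"
    by simp
  also have "\<dots> = (\<integral>\<^sup>+n. (\<integral>\<^sup>+x. f x * indicator (cell n) x \<partial>lborel) \<partial>count_space UNIV)"
    by (rule Fubini'[symmetric]) (simp add: cell_def)
  also have "\<dots> = (\<integral>\<^sup>+n. (\<integral>\<^sup>+y. f (y + of_int n * p) * indicator {0..<p} y \<partial>lborel)
      \<partial>count_space UNIV)"
  proof (rule nn_integral_cong)
    fix n :: int
    have "(\<integral>\<^sup>+x. f x * indicator (cell n) x \<partial>lborel)
        = (\<integral>\<^sup>+y. f (of_int n * p + y) * indicator (cell n) (of_int n * p + y) \<partial>lborel)"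
      by (rule nn_integral_lborel_translate[symmetric]) (simp add: cell_def)
    then show "(\<integral>\<^sup>+x. f x * indicator (cell n) x \<partial>lborel)
        = (\<integral>\<^sup>+y. f (y + of_int n * p) * indicator {0..<p} y \<partial>lborel)"
      by (simp add: cell_def indicator_def add.commute)
  qed
  also have "\<dots> = (\<integral>\<^sup>+y. (\<integral>\<^sup>+n. f (y + of_int n * p) * indicator {0..<p} y \<partial>count_space UNIV)
      \<partial>lborel)"
    by (rule Fubini') simp
  also have "\<dots> = (\<integral>\<^sup>+y\<in>{0..<p}. (\<integral>\<^sup>+n. f (y + of_int n * p) \<partial>count_space UNIV) \<partial>lborel)"
    by (simp add: nn_integral_multc)
  finally show ?thesis .
qed

definition angular_window :: "real \<Rightarrow> real \<Rightarrow> real set" where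
  "angular_window t d = {y. \<exists>n::int. \<bar>y - t - 2 * pi * of_int n\<bar> < d}"

lemma angular_window_borel [measurable]: "angular_window t d \<in> sets borel"
proof -
  have "open (\<Union>n::int. {y. \<bar>y - t - 2 * pi * of_int n\<bar> < d})"
    by (intro open_UN ballI open_Collect_less continuous_intros)
  also have "(\<Union>n::int. {y. \<bar>y - t - 2 * pi * of_int n\<bar> < d}) = angular_window t d"
    by (auto simp: angular_window_def)
  finally show ?thesis by simp
qed

lemma rmod_measurable [measurable]: "(\<lambda>x. x rmod p) \<in> borel_measurable borel"
  unfolding rmod_def by measurable

lemma translate_in_interval_unique:
  fixes k :: int and x :: real
  assumes "x \<in> {-d<..<d}" "x + of_int k * p \<in> {-d<..<d}" and p: "2 * d \<le> p"
  shows "k = 0"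
proof (rule ccontr)
  assume "k \<noteq> 0"
  then have "1 \<le> \<bar>real_of_int k\<bar>"
    by linarith
  moreover have "0 < p" and "\<bar>of_int k * p\<bar> < 2 * d"
    using assms by auto
  ultimately have "1 * p \<le> \<bar>of_int k\<bar> * p" and "\<bar>of_int k\<bar> * p < 2 * d"
    by (auto simp: abs_mult intro: mult_right_mono)
  with p show False by simp
qed

lemma nn_integral_translates_window:
  assumes "0 < d" "d \<le> pi"
  shows "(\<integral>\<^sup>+n. indicator {-d<..<d} (y + of_int n * (2 * pi) - t) \<partial>count_space UNIV)
    = indicator (angular_window t d) y"
proof (cases "y \<in> angular_window t d")
  case True
  then obtain n :: int where "\<bar>y - t - 2 * pi * of_int n\<bar> < d"
    by (auto simp: angular_window_def)
  then have n: "y + of_int (- n) * (2 * pi) - t \<in> {-d<..<d}"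
    by (simp add: abs_less_iff algebra_simps)
  have "k = - n" if k: "y + of_int k * (2 * pi) - t \<in> {-d<..<d}" for k
  proof -
    have "y + of_int (- n) * (2 * pi) - t + of_int (k + n) * (2 * pi) \<in> {-d<..<d}"
      using k by (simp add: algebra_simps)
    from translate_in_interval_unique[OF n this] assms show ?thesis by simp
  qed
  then have "indicator {-d<..<d} (y + of_int k * (2 * pi) - t) = (indicator {- n} k :: ennreal)"
    for k
    using n by (auto simp: indicator_def)
  then show ?thesis
    using True by simp
next
  case False
  have "y + of_int k * (2 * pi) - t \<notin> {-d<..<d}" for k
    using False[unfolded angular_window_def mem_Collect_eq not_ex, rule_format, of "- k"]
    by (auto simp: abs_less_iff algebra_simps)
  then show ?thesis
    using False by simp
qed

lemma nn_integral_angular_window: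
  fixes f :: "real \<Rightarrow> ennreal"
  assumes d: "0 < d" "d \<le> pi" and f [measurable]: "f \<in> borel_measurable borel"
  shows "(\<integral>\<^sup>+y\<in>{0..<2 * pi}. (indicator (angular_window t d) y * f y) \<partial>lborel)
    = (\<integral>\<^sup>+x. indicator {-d<..<d} x * f ((t + x) rmod (2 * pi)) \<partial>lborel)"
proof -
  define h where "h = (\<lambda>x. indicator {-d<..<d} (x - t) * f (x rmod (2 * pi)))"
  have h: "h \<in> borel_measurable borel"
    unfolding h_def by measurable
  have "(\<integral>\<^sup>+n. h (y + of_int n * (2 * pi)) \<partial>count_space UNIV)
      = indicator (angular_window t d) y * f y"
    if "y \<in> {0..<2 * pi}" for y
  proof -
    have "(y + of_int n * (2 * pi)) rmod (2 * pi) = y" for n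
      by (rule rmod_unique[of _ _ _ n]) (use that in auto)
    then show ?thesis
      by (simp add: h_def nn_integral_multc nn_integral_translates_window[OF d])
  qed
  then have "(\<integral>\<^sup>+y\<in>{0..<2 * pi}. (indicator (angular_window t d) y * f y) \<partial>lborel)
      = (\<integral>\<^sup>+x. h x \<partial>lborel)"
    unfolding nn_integral_periodization[OF _ h, of "2 * pi", simplified]
    by (intro nn_integral_cong) (simp add: indicator_def)
  also have "\<dots> = (\<integral>\<^sup>+x. h (t + x) \<partial>lborel)"
    using nn_integral_lborel_translate[OF h] by simp
  finally show ?thesis
    by (simp add: h_def)
qed

lemma density_angular_window:
  fixes t d :: real
  assumes d: "0 < d" "d \<le> pi"
  defines "circle \<equiv> restrict_space lborel {0..<2 * pi}"
  shows "density circle (indicator (angular_window t d))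
    = distr (density lborel (indicator {-d<..<d})) circle (\<lambda>x. (t + x) rmod (2 * pi))"
proof (rule measure_eqI)
  have wrap: "(\<lambda>x. (t + x) rmod (2 * pi)) \<in> measurable lborel circle"
    unfolding circle_def by (rule measurable_restrict_space2) (auto simp: rmod_nonneg rmod_less)
  fix A assume A: "A \<in> sets (density circle (indicator (angular_window t d)))"
  then have "A \<in> sets borel"
    by (auto simp: circle_def sets_restrict_space)
  note [measurable] = this
  have "emeasure (density circle (indicator (angular_window t d))) A
      = (\<integral>\<^sup>+y. indicator (angular_window t d) y * indicator A y \<partial>circle)"
    using A by (intro emeasure_density) (auto simp: circle_def intro!: measurable_restrict_space1)
  also have "\<dots> = (\<integral>\<^sup>+y\<in>{0..<2 * pi}. (indicator (angular_window t d) y * indicator A y) \<partial>lborel)"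
    unfolding circle_def by (rule nn_integral_restrict_space) simp
  also have "\<dots> = (\<integral>\<^sup>+x. indicator {-d<..<d} x * indicator A ((t + x) rmod (2 * pi)) \<partial>lborel)"
    by (rule nn_integral_angular_window[OF d]) simp
  also have "\<dots>
      = emeasure (distr (density lborel (indicator {-d<..<d})) circle (\<lambda>x. (t + x) rmod (2 * pi))) A"
    using A wrap measurable_sets[OF wrap, of A]
    by (subst emeasure_distr) (simp_all add: emeasure_density indicator_vimage)
  finally show "emeasure (density circle (indicator (angular_window t d))) A
      = emeasure (distr (density lborel (indicator {-d<..<d})) circle (\<lambda>x. (t + x) rmod (2 * pi))) A" .
qed simp

lemma continuous_mono_image_Icc:
  fixes g :: "real \<Rightarrow> real"
  assumes "a \<le> b" and cont: "continuous_on {a..b} g" and mono: "mono_on {a..b} g"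
  shows "g ` {a..b} = {g a..g b}"
proof (intro equalityI subsetI)
  fix y assume "y \<in> {g a..g b}"
  then show "y \<in> g ` {a..b}"
    using IVT'[of g a y b] assms by auto
qed (use assms in \<open>auto intro: mono_onD[OF mono]\<close>)

lemma nn_integral_substitution_real_line:
  fixes f :: "real \<Rightarrow> ennreal" and g g' :: "real \<Rightarrow> real"
  assumes f [measurable]: "f \<in> borel_measurable borel"
    and deriv: "\<And>x. (g has_real_derivative g' x) (at x)"
    and cont: "continuous_on UNIV g'" and nonneg: "\<And>x. 0 \<le> g' x"
  shows "(\<integral>\<^sup>+y. f y * indicator (range g) y \<partial>lborel) = (\<integral>\<^sup>+x. f (g x) * ennreal (g' x) \<partial>lborel)"
proof -
  define A where "A = (\<lambda>n::nat. {g (- real (Suc n))..g (real (Suc n))})"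
  define B where "B = (\<lambda>n::nat. {- real (Suc n)..real (Suc n)})"
  have g_cont: "continuous_on UNIV g"
    using deriv by (intro continuous_at_imp_continuous_on ballI DERIV_isCont)
  have [measurable]: "g \<in> borel_measurable borel" "g' \<in> borel_measurable borel"
    using g_cont cont by (auto intro: borel_measurable_continuous_onI)
  have mono: "g x \<le> g y" if "x \<le> y" for x y
    using that by (rule DERIV_nonneg_imp_nondecreasing) (use deriv nonneg in blast)
  have inc: "incseq A" "incseq B"
    by (auto simp: incseq_def A_def B_def intro!: mono
      intro: order_trans[OF mono] order_trans[OF _ mono])
  have "\<exists>n. x \<in> B n" for x
    using real_arch_simple[of "\<bar>x\<bar> - 1"]
    unfolding B_def atLeastAtMost_iff by (elim ex_forward) linarith
  moreover have "A n = g ` B n" for n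
    unfolding A_def B_def using continuous_on_subset[OF g_cont] mono
    by (intro continuous_mono_image_Icc[symmetric] mono_onI) auto
  ultimately have unions: "(\<Union>n. A n) = range g" "(\<Union>n. B n) = UNIV"
    by (auto simp: image_iff) metis
  have emeasure_A: "emeasure (density lborel f) (A n)
      = emeasure (density lborel (\<lambda>x. f (g x) * ennreal (g' x))) (B n)" for n
    using nn_integral_substitution_aux[of f "- real (Suc n)" "real (Suc n)" g g'] deriv nonneg
      continuous_on_subset[OF cont]
    by (simp add: A_def B_def emeasure_density)
  have "(\<integral>\<^sup>+y. f y * indicator (range g) y \<partial>lborel) = emeasure (density lborel f) (\<Union>n. A n)"
    unfolding unions(1)[symmetric] by (subst emeasure_density) (auto simp: A_def)
  also have "\<dots> = (SUP n. emeasure (density lborel f) (A n))"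
    by (rule SUP_emeasure_incseq[OF _ inc(1), symmetric]) (auto simp: A_def)
  also have "\<dots> = emeasure (density lborel (\<lambda>x. f (g x) * ennreal (g' x))) (\<Union>n. B n)"
    unfolding emeasure_A by (rule SUP_emeasure_incseq[OF _ inc(2)]) (auto simp: B_def)
  also have "\<dots> = (\<integral>\<^sup>+x. f (g x) * ennreal (g' x) \<partial>lborel)"
    unfolding unions(2) by (subst emeasure_density) auto
  finally show ?thesis .
qed

definition squash :: "real \<Rightarrow> real \<Rightarrow> real" where
  "squash c x = arctan (c * x) / c"

lemma squash_deriv:
  assumes "c > 0"
  shows "(squash c has_real_derivative 1 / (1 + (c * x)\<^sup>2)) (at x)"
proof -
  have "((\<lambda>x. arctan (c * x)) has_real_derivative c / (1 + (c * x)\<^sup>2)) (at x)"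
    by (auto intro!: derivative_eq_intros simp: field_simps)
  from DERIV_cdivide[OF this, of c] show ?thesis
    using assms by (simp add: squash_def[abs_def])
qed

lemma squash_measurable [measurable]: "squash c \<in> borel_measurable borel"
  unfolding squash_def[abs_def] by measurable

lemma squash_contraction:
  assumes "c > 0"
  shows "\<bar>squash c x - squash c y\<bar> \<le> \<bar>x - y\<bar>"
proof -
  have "norm (squash c x - squash c y) \<le> 1 * norm (x - y)"
  proof (rule field_differentiable_bound[of UNIV])
    show "(squash c has_field_derivative 1 / (1 + (c * z)\<^sup>2)) (at z within UNIV)" for z
      using squash_deriv[OF assms] by simp
    show "norm (1 / (1 + (c * z)\<^sup>2)) \<le> 1" for z
      by (simp add: divide_le_eq add_pos_nonneg not_less)
  qed auto
  then show ?thesis by simp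
qed

lemma abs_squash_less:
  assumes "c > 0"
  shows "\<bar>squash c x\<bar> < pi / (2 * c)"
proof -
  have "\<bar>arctan (c * x)\<bar> < pi / 2"
    using arctan_lbound[of "c * x"] arctan_ubound[of "c * x"] by linarith
  then show ?thesis
    using assms by (simp add: squash_def abs_divide less_divide_eq divide_less_eq)
qed

lemma range_squash:
  assumes c: "c > 0"
  shows "range (squash c) = {- (pi / (2 * c))<..<pi / (2 * c)}"
proof (intro equalityI subsetI)
  fix y assume "y \<in> range (squash c)"
  then show "y \<in> {- (pi / (2 * c))<..<pi / (2 * c)}"
    using abs_squash_less[OF c]
    by (auto simp only: greaterThanLessThan_iff abs_less_iff minus_less_iff)
next
  fix y assume "y \<in> {- (pi / (2 * c))<..<pi / (2 * c)}"
  then have "arctan (tan (c * y)) = c * y"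
    using c by (intro arctan_tan) (auto simp: field_simps)
  then have "y = squash c (tan (c * y) / c)"
    using c by (simp add: squash_def)
  then show "y \<in> range (squash c)" by blast
qed

lemma density_squash:
  assumes c: "c > 0"
  shows "density lborel (indicator {- (pi / (2 * c))<..<pi / (2 * c)})
    = distr (density lborel (\<lambda>x. ennreal (1 / (1 + (c * x)\<^sup>2)))) lborel (squash c)"
proof (rule measure_eqI)
  fix A
  assume "A \<in> sets (density lborel (indicator {- (pi / (2 * c))<..<pi / (2 * c)} :: real \<Rightarrow> ennreal))"
  then have [measurable]: "A \<in> sets borel" by simp
  have "emeasure (density lborel (indicator {- (pi / (2 * c))<..<pi / (2 * c)})) A
      = (\<integral>\<^sup>+y. indicator A y * indicator (range (squash c)) y \<partial>lborel)"
    by (subst emeasure_density) (simp_all add: range_squash[OF c] mult.commute)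
  also have "\<dots> = (\<integral>\<^sup>+x. indicator A (squash c x) * ennreal (1 / (1 + (c * x)\<^sup>2)) \<partial>lborel)"
    by (rule nn_integral_substitution_real_line[OF _ squash_deriv[OF c]])
       (auto intro!: continuous_intros simp: add_nonneg_eq_0_iff)
  also have "\<dots>
      = emeasure (distr (density lborel (\<lambda>x. ennreal (1 / (1 + (c * x)\<^sup>2)))) lborel (squash c)) A"
    using measurable_sets[OF squash_measurable, of A c]
    by (subst emeasure_distr) (simp_all add: emeasure_density indicator_vimage mult.commute)
  finally show "emeasure (density lborel (indicator {- (pi / (2 * c))<..<pi / (2 * c)})) A
      = emeasure (distr (density lborel (\<lambda>x. ennreal (1 / (1 + (c * x)\<^sup>2)))) lborel (squash c)) A" .
qed simp

subsection \<open>Comparison with the harmonic model\<close>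

definition axis_angle :: "3 \<Rightarrow> real" where
  "axis_angle a = (if a = 1 then 0 else if a = 2 then - (2 * pi / 3) else 2 * pi / 3)"

definition stiffness :: "real \<Rightarrow> 3 \<Rightarrow> real" where
  "stiffness t a = (sin (t + axis_angle a))\<^sup>2"

lemma stiffness_nonneg [simp]: "0 \<le> stiffness t a"
  by (simp add: stiffness_def)

lemma hamiltonian_eq:
  "hamiltonian J L \<theta> = J / 2 * (\<Sum>r\<in>torus L. \<Sum>a\<in>UNIV.
     (cos (\<theta> r + axis_angle a) - cos (\<theta> (shift L a r) + axis_angle a))\<^sup>2)"
  by (simp add: hamiltonian_def sum_3 axis_angle_def shift_def)

lemma hamiltonian_cong:
  assumes "\<And>r. r \<in> torus L \<Longrightarrow> \<theta> r = \<theta>' r"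
  shows "hamiltonian J L \<theta> = hamiltonian J L \<theta>'"
  unfolding hamiltonian_eq
  by (intro arg_cong[where f = "(*) (J / 2)"] sum.cong refl) (simp add: assms shift_in_torus)

lemma hamiltonian_measurable:
  assumes f: "\<And>r. r \<in> torus L \<Longrightarrow> (\<lambda>x. f x r) \<in> borel_measurable M"
  shows "(\<lambda>x. hamiltonian J L (f x)) \<in> borel_measurable M"
  unfolding hamiltonian_eq
proof (intro borel_measurable_times borel_measurable_sum borel_measurable_const)
  fix r a assume r: "r \<in> torus L"
  note [measurable] = f[OF r] f[OF shift_in_torus[OF r]]
  show "(\<lambda>x. (cos (f x r + axis_angle a) - cos (f x (shift L a r) + axis_angle a))\<^sup>2)
      \<in> borel_measurable M"
    by measurable
qed

lemma hamiltonian_rmod: "hamiltonian J L (\<lambda>r\<in>torus L. u r rmod (2 * pi)) = hamiltonian J L u"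
  unfolding hamiltonian_eq
  by (intro arg_cong[where f = "(*) (J / 2)"] sum.cong refl) (simp add: shift_in_torus cos_add)

lemma chi_eq_prod: "chi d t L \<theta> = (\<Prod>r\<in>torus L. indicator (angular_window t d) (\<theta> r))"
proof (cases "\<forall>r\<in>torus L. \<theta> r \<in> angular_window t d")
  case True
  then show ?thesis
    by (simp add: chi_def angular_window_def)
next
  case False
  then obtain r where "r \<in> torus L" "\<theta> r \<notin> angular_window t d" by blast
  then show ?thesis
    by (auto simp: chi_def angular_window_def intro!: prod_zero[symmetric] bexI[of _ r])
qed

definition partition_function :: "real \<Rightarrow> real \<Rightarrow> real \<Rightarrow> nat \<Rightarrow> real \<Rightarrow> ennreal" where
  "partition_function J d \<beta> L t
     = (\<integral>\<^sup>+\<theta>. ennreal (exp (- \<beta> * hamiltonian J L \<theta>) * chi d t L \<theta>) \<partial>config_measure L)"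

lemma config_component_measurable:
  assumes "r \<in> torus L"
  shows "(\<lambda>\<theta>. \<theta> r) \<in> borel_measurable (config_measure L)"
  unfolding config_measure_def
  by (rule measurable_compose[OF measurable_component_singleton[OF assms]])
     (auto intro!: measurable_restrict_space1)

lemma hamiltonian_borel_measurable [measurable]:
  "hamiltonian J L \<in> borel_measurable (config_measure L)"
  by (rule hamiltonian_measurable[OF config_component_measurable])

lemma restricted_free_energy_eq:
  "restricted_free_energy J d \<beta> L t
    = - ln (\<beta> * J / (2 * pi)) / 2 - ln (enn2real (partition_function J d \<beta> L t)) / real L ^ 3"
proof -
  have [measurable]: "chi d t L \<in> borel_measurable (config_measure L)"
    unfolding chi_eq_prod[abs_def]
    by (intro borel_measurable_prod measurable_compose[OF config_component_measurable]) simp_all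
  have "(\<integral>\<theta>. exp (- \<beta> * hamiltonian J L \<theta>) * chi d t L \<theta> \<partial>config_measure L)
      = enn2real (partition_function J d \<beta> L t)"
    unfolding partition_function_def
    by (rule integral_eq_nn_integral) (measurable, simp add: chi_def)
  then show ?thesis
    by (simp add: restricted_free_energy_def)
qed

lemma partition_function_eq_box_integral:
  assumes d: "0 < d" "d \<le> pi"
  shows "partition_function J d \<beta> L t
    = (\<integral>\<^sup>+x. (\<Prod>r\<in>torus L. indicator {-d<..<d} (x r))
        * ennreal (exp (- \<beta> * hamiltonian J L (\<lambda>r. t + x r))) \<partial>PiM (torus L) (\<lambda>_. lborel))"
proof -
  define circle :: "real measure" where "circle = restrict_space lborel {0..<2 * pi}"
  define weight where "weight = (\<lambda>\<theta>. ennreal (exp (- \<beta> * hamiltonian J L \<theta>)))"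
  have config: "config_measure L = PiM (torus L) (\<lambda>_. circle)"
    by (simp add: config_measure_def circle_def)
  have circle: "sigma_finite_measure circle"
    unfolding circle_def
    by (rule sigma_finite_measure_restrict_space) (auto intro: lborel.sigma_finite_measure_axioms)
  have window: "indicator (angular_window t d) \<in> borel_measurable circle"
    unfolding circle_def by (rule measurable_restrict_space1) measurable
  have rmod: "(\<lambda>x. (t + x) rmod (2 * pi)) \<in> measurable lborel circle"
    unfolding circle_def by (rule measurable_restrict_space2) (auto simp: rmod_nonneg rmod_less)
  have weight: "weight \<in> borel_measurable (PiM (torus L) (\<lambda>_. circle))"
    unfolding weight_def config[symmetric] by measurable
  have "partition_function J d \<beta> L t
      = (\<integral>\<^sup>+\<theta>. (\<Prod>r\<in>torus L. indicator (angular_window t d) (\<theta> r)) * weight \<theta>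
          \<partial>PiM (torus L) (\<lambda>_. circle))"
    unfolding partition_function_def config
    by (intro nn_integral_cong)
       (simp add: weight_def chi_eq_prod ennreal_mult'' prod_nonneg mult.commute
          flip: prod_ennreal ennreal_indicator)
  also have "\<dots> = (\<integral>\<^sup>+x. (\<Prod>r\<in>torus L. indicator {-d<..<d} (x r))
      * weight (\<lambda>r\<in>torus L. (t + x r) rmod (2 * pi)) \<partial>PiM (torus L) (\<lambda>_. lborel))"
    by (rule nn_integral_PiM_substitution[OF finite_torus circle lborel.sigma_finite_measure_axioms
          window _ _ _ rmod _ weight])
       (simp_all add: density_angular_window[OF d, folded circle_def] split: split_indicator)
  finally show ?thesis
    by (simp add: weight_def hamiltonian_rmod)
qed

lemma partition_function_eq_squash_integral:
  assumes d: "0 < d" "d \<le> pi" and c: "c = pi / (2 * d)"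
  shows "partition_function J d \<beta> L t
    = (\<integral>\<^sup>+x. (\<Prod>r\<in>torus L. ennreal (1 / (1 + (c * x r)\<^sup>2)))
        * ennreal (exp (- \<beta> * hamiltonian J L (\<lambda>r. t + squash c (x r))))
            \<partial>PiM (torus L) (\<lambda>_. lborel))"
proof -
  define weight where "weight = (\<lambda>x. ennreal (exp (- \<beta> * hamiltonian J L (\<lambda>r. t + x r))))"
  have "(\<lambda>x. hamiltonian J L (\<lambda>r. t + x r)) \<in> borel_measurable (PiM (torus L) (\<lambda>_. lborel))"
    by (rule hamiltonian_measurable) simp
  then have weight: "weight \<in> borel_measurable (PiM (torus L) (\<lambda>_. lborel))"
    unfolding weight_def by measurable
  have "c > 0" "pi / (2 * c) = d"
    using d c by simp_all
  then have substitution: "density lborel (indicator {-d<..<d})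
      = distr (density lborel (\<lambda>x. ennreal (1 / (1 + (c * x)\<^sup>2)))) lborel (squash c)"
    using density_squash[of c] by simp
  have restricted: "weight (\<lambda>r\<in>torus L. squash c (x r))
      = ennreal (exp (- \<beta> * hamiltonian J L (\<lambda>r. t + squash c (x r))))" for x
    unfolding weight_def by (subst hamiltonian_cong[of L _ "\<lambda>r. t + squash c (x r)"]) simp_all
  have "partition_function J d \<beta> L t
      = (\<integral>\<^sup>+x. (\<Prod>r\<in>torus L. indicator {-d<..<d} (x r)) * weight x \<partial>PiM (torus L) (\<lambda>_. lborel))"
    unfolding weight_def by (rule partition_function_eq_box_integral[OF d])
  also have "\<dots> = (\<integral>\<^sup>+x. (\<Prod>r\<in>torus L. ennreal (1 / (1 + (c * x r)\<^sup>2)))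
      * weight (\<lambda>r\<in>torus L. squash c (x r)) \<partial>PiM (torus L) (\<lambda>_. lborel))"
    by (rule nn_integral_PiM_substitution[OF finite_torus _ _ _ _ _ _ _ substitution weight])
       (simp_all add: lborel.sigma_finite_measure_axioms split: split_indicator)
  finally show ?thesis
    unfolding restricted .
qed

lemma abs_sin_diff_le: "\<bar>sin x - sin y\<bar> \<le> \<bar>x - y :: real\<bar>"
  using field_differentiable_bound[of UNIV sin cos 1 x y]
  by (simp add: DERIV_sin abs_cos_le_one)

lemma cos_diff_square_harmonic:
  fixes a x y :: real
  assumes x: "\<bar>x\<bar> \<le> d" and y: "\<bar>y\<bar> \<le> d"
  shows "\<bar>(cos (a + x) - cos (a + y))\<^sup>2 - (sin a)\<^sup>2 * (x - y)\<^sup>2\<bar> \<le> 8 * d ^ 3"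
proof -
  define u where "u = cos (a + x) - cos (a + y)"
  define v where "v = - sin a * (x - y)"
  have "norm ((cos (a + x) + sin a * x) - (cos (a + y) + sin a * y)) \<le> d * norm (x - y)"
  proof (rule field_differentiable_bound[of "{-d..d}"])
    show "((\<lambda>z. cos (a + z) + sin a * z) has_field_derivative sin a - sin (a + z))
        (at z within {-d..d})" for z
      by (auto intro!: derivative_eq_intros)
    show "norm (sin a - sin (a + z)) \<le> d" if "z \<in> {-d..d}" for z
      using abs_sin_diff_le[of a "a + z"] that by auto
  qed (use x y in auto)
  then have minus: "\<bar>u - v\<bar> \<le> d * \<bar>x - y\<bar>"
    by (simp add: u_def v_def algebra_simps)
  have xy: "\<bar>x - y\<bar> \<le> 2 * d"
    using x y by linarith
  have "\<bar>u\<bar> \<le> \<bar>x - y\<bar>"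
    using abs_sin_diff_le[of "a + x + pi / 2" "a + y + pi / 2"] by (simp add: u_def sin_add)
  moreover have "\<bar>v\<bar> \<le> \<bar>x - y\<bar>"
    using mult_right_mono[OF abs_sin_le_one[of a], of "\<bar>x - y\<bar>"] by (simp add: v_def abs_mult)
  ultimately have plus: "\<bar>u + v\<bar> \<le> 4 * d"
    using xy by linarith
  have "\<bar>u - v\<bar> \<le> d * (2 * d)"
    using minus mult_left_mono[OF xy, of d] x by linarith
  then have "\<bar>(u - v) * (u + v)\<bar> \<le> d * (2 * d) * (4 * d)"
    unfolding abs_mult using plus by (rule mult_mono) (use x in auto)
  also have "(u - v) * (u + v) = (cos (a + x) - cos (a + y))\<^sup>2 - (sin a)\<^sup>2 * (x - y)\<^sup>2"
    by (simp add: u_def v_def power2_eq_square algebra_simps)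
  finally show ?thesis
    by (simp add: power3_eq_cube mult_ac)
qed

abbreviation torus_dirichlet :: "real \<Rightarrow> nat \<Rightarrow> (nat \<times> nat \<times> nat \<Rightarrow> real) \<Rightarrow> real" where
  "torus_dirichlet t L \<equiv> dirichlet_energy (shift L) (stiffness t) (torus L)"

abbreviation torus_energy :: "real \<Rightarrow> real \<Rightarrow> nat \<Rightarrow> (nat \<times> nat \<times> nat \<Rightarrow> real) \<Rightarrow> real" where
  "torus_energy t m L \<equiv> massive_energy (shift L) (stiffness t) m (torus L)"

lemma hamiltonian_harmonic:
  assumes J: "J \<ge> 0" and x: "\<And>r. r \<in> torus L \<Longrightarrow> \<bar>x r\<bar> \<le> d"
  shows "\<bar>hamiltonian J L (\<lambda>r. t + x r) - J / 2 * torus_dirichlet t L x\<bar>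
    \<le> 12 * J * d ^ 3 * real L ^ 3"
proof -
  define e where "e = (\<lambda>r a. (cos (t + axis_angle a + x r) - cos (t + axis_angle a + x (shift L a r)))\<^sup>2
      - (sin (t + axis_angle a))\<^sup>2 * (x r - x (shift L a r))\<^sup>2)"
  have error: "hamiltonian J L (\<lambda>r. t + x r) - J / 2 * torus_dirichlet t L x
      = J / 2 * (\<Sum>r\<in>torus L. \<Sum>a\<in>UNIV. e r a)"
    by (simp add: hamiltonian_eq dirichlet_energy_def stiffness_def e_def sum_subtractf
        right_diff_distrib add_ac)
  have "\<bar>\<Sum>r\<in>torus L. \<Sum>a\<in>UNIV. e r a\<bar> \<le> (\<Sum>r\<in>torus L. \<Sum>a\<in>(UNIV :: 3 set). 8 * d ^ 3)"
  proof (intro order_trans[OF sum_abs] sum_mono)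
    fix r a assume "r \<in> torus L"
    then show "\<bar>e r a\<bar> \<le> 8 * d ^ 3"
      unfolding e_def by (intro cos_diff_square_harmonic x shift_in_torus)
  qed
  then have "J / 2 * \<bar>\<Sum>r\<in>torus L. \<Sum>a\<in>UNIV. e r a\<bar> \<le> J / 2 * (real L ^ 3 * (24 * d ^ 3))"
    using J by (intro mult_left_mono) (simp_all add: card_torus)
  then show ?thesis
    unfolding error abs_mult using J by (simp add: mult_ac)
qed

lemma torus_energy_measurable [measurable]:
  "torus_energy t m L \<in> borel_measurable (PiM (torus L) (\<lambda>_. lborel))"
  unfolding massive_energy_def[abs_def] dirichlet_energy_def
  by (intro borel_measurable_add borel_measurable_times borel_measurable_sum borel_measurable_power
      borel_measurable_diff borel_measurable_const) (simp_all add: shift_in_torus)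

lemma boltzmann_weight_le:
  assumes pos: "J > 0" "\<beta> > 0" "m > 0" and x: "\<And>r. r \<in> torus L \<Longrightarrow> \<bar>x r\<bar> \<le> d"
  shows "exp (- \<beta> * hamiltonian J L (\<lambda>r. t + x r))
    \<le> exp (real L ^ 3 * (12 * (\<beta> * J) * d ^ 3 + \<beta> * J * m * d\<^sup>2 / 2))
      * exp (- (\<beta> * J / 2 * torus_energy t m L x))"
proof -
  have "J / 2 * torus_dirichlet t L x - 12 * J * d ^ 3 * real L ^ 3
      \<le> hamiltonian J L (\<lambda>r. t + x r)"
    using hamiltonian_harmonic[of J L x d t] x pos by (simp add: abs_le_iff)
  then have gradient: "\<beta> * (J / 2 * torus_dirichlet t L x - 12 * J * d ^ 3 * real L ^ 3)
      \<le> \<beta> * hamiltonian J L (\<lambda>r. t + x r)"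
    using pos by (intro mult_left_mono) auto
  have "(x r)\<^sup>2 \<le> d\<^sup>2" if "r \<in> torus L" for r
    using power_mono[OF x[OF that], of 2] by simp
  then have "(\<Sum>r\<in>torus L. (x r)\<^sup>2) \<le> real L ^ 3 * d\<^sup>2"
    using sum_mono[of "torus L" "\<lambda>r. (x r)\<^sup>2" "\<lambda>_. d\<^sup>2"] by (simp add: card_torus)
  then have mass: "\<beta> * J / 2 * m * (\<Sum>r\<in>torus L. (x r)\<^sup>2) \<le> \<beta> * J / 2 * m * (real L ^ 3 * d\<^sup>2)"
    using pos by (intro mult_left_mono) auto
  show ?thesis
    using gradient mass by (simp add: massive_energy_def algebra_simps flip: exp_add)
qed

lemma exp_neg_sum_squares_le:
  "exp (- (\<Sum>r\<in>T. (y r)\<^sup>2)) \<le> (\<Prod>r\<in>T. 1 / (1 + (y r :: real)\<^sup>2))"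
proof (cases "finite T")
  case True
  have "exp (- z\<^sup>2) \<le> 1 / (1 + z\<^sup>2)" for z :: real
    using exp_ge_add_one_self[of "z\<^sup>2"]
    by (simp add: exp_minus inverse_eq_divide frac_le add_pos_nonneg)
  then have "(\<Prod>r\<in>T. exp (- (y r)\<^sup>2)) \<le> (\<Prod>r\<in>T. 1 / (1 + (y r)\<^sup>2))"
    by (intro prod_mono) simp
  then show ?thesis
    by (simp add: exp_sum[OF True] flip: sum_negf)
qed simp

lemma hamiltonian_squash_le:
  assumes J: "J \<ge> 0" and d: "d > 0" and c: "c = pi / (2 * d)"
  shows "hamiltonian J L (\<lambda>r. t + squash c (x r))
      \<le> J / 2 * torus_dirichlet t L x + 12 * J * d ^ 3 * real L ^ 3"
proof -
  have c_pos: "c > 0"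
    using d c by simp
  have "\<bar>squash c (x r)\<bar> \<le> d" for r
    using abs_squash_less[OF c_pos, of "x r"] c d by simp
  then have "\<bar>hamiltonian J L (\<lambda>r. t + squash c (x r))
      - J / 2 * torus_dirichlet t L (\<lambda>r. squash c (x r))\<bar>
      \<le> 12 * J * d ^ 3 * real L ^ 3"
    by (intro hamiltonian_harmonic J)
  moreover have "torus_dirichlet t L (\<lambda>r. squash c (x r)) \<le> torus_dirichlet t L x"
    unfolding dirichlet_energy_def
    by (intro sum_mono mult_left_mono stiffness_nonneg abs_le_square_iff[THEN iffD1]
      squash_contraction c_pos)
  then have "J / 2 * torus_dirichlet t L (\<lambda>r. squash c (x r)) \<le> J / 2 * torus_dirichlet t L x"
    using J by (intro mult_left_mono) simp_all
  ultimately show ?thesis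
    by linarith
qed

lemma boltzmann_weight_squash_ge:
  assumes pos: "J > 0" "\<beta> > 0" "d > 0" and c: "c = pi / (2 * d)"
    and m: "pi\<^sup>2 \<le> 2 * (\<beta> * J) * d\<^sup>2 * m"
  shows "exp (- (real L ^ 3 * (12 * (\<beta> * J) * d ^ 3))) * exp (- (\<beta> * J / 2 * torus_energy t m L x))
    \<le> (\<Prod>r\<in>torus L. 1 / (1 + (c * x r)\<^sup>2)) * exp (- \<beta> * hamiltonian J L (\<lambda>r. t + squash c (x r)))"
proof -
  have gradient: "\<beta> * hamiltonian J L (\<lambda>r. t + squash c (x r))
      \<le> \<beta> * (J / 2 * torus_dirichlet t L x + 12 * J * d ^ 3 * real L ^ 3)"
    using pos c by (intro mult_left_mono hamiltonian_squash_le) simp_all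
  have "c\<^sup>2 \<le> \<beta> * J / 2 * m"
    using pos m by (simp add: c power_divide divide_le_eq mult_ac)
  then have "c\<^sup>2 * (\<Sum>r\<in>torus L. (x r)\<^sup>2) \<le> \<beta> * J / 2 * m * (\<Sum>r\<in>torus L. (x r)\<^sup>2)"
    by (intro mult_right_mono sum_nonneg) simp_all
  then have mass: "(\<Sum>r\<in>torus L. (c * x r)\<^sup>2) \<le> \<beta> * J / 2 * m * (\<Sum>r\<in>torus L. (x r)\<^sup>2)"
    by (simp add: power_mult_distrib sum_distrib_left)
  have "exp (- (real L ^ 3 * (12 * (\<beta> * J) * d ^ 3))) * exp (- (\<beta> * J / 2 * torus_energy t m L x))
      \<le> exp (- (\<Sum>r\<in>torus L. (c * x r)\<^sup>2)) * exp (- \<beta> * hamiltonian J L (\<lambda>r. t + squash c (x r)))"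
    unfolding exp_add[symmetric] exp_le_cancel_iff massive_energy_def
    using gradient mass by (simp add: algebra_simps)
  also have "\<dots> \<le> (\<Prod>r\<in>torus L. 1 / (1 + (c * x r)\<^sup>2))
      * exp (- \<beta> * hamiltonian J L (\<lambda>r. t + squash c (x r)))"
    by (intro mult_right_mono exp_neg_sum_squares_le) simp
  finally show ?thesis .
qed

lemma partition_function_le:
  assumes d: "0 < d" "d \<le> pi" and pos: "J > 0" "\<beta> > 0" "m > 0" "L > 0"
  shows "partition_function J d \<beta> L t
      \<le> ennreal (exp (real L ^ 3 * (12 * (\<beta> * J) * d ^ 3 + \<beta> * J * m * d\<^sup>2 / 2
      - gaussian_free_energy (stiffness t) (\<beta> * J) m L)))"
proof -
  define C where "C = real L ^ 3 * (12 * (\<beta> * J) * d ^ 3 + \<beta> * J * m * d\<^sup>2 / 2)"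
  have pointwise: "(\<Prod>r\<in>torus L. indicator {-d<..<d} (x r))
      * ennreal (exp (- \<beta> * hamiltonian J L (\<lambda>r. t + x r)))
      \<le> ennreal (exp C) * ennreal (exp (- (\<beta> * J / 2 * torus_energy t m L x)))" for x
  proof (cases "\<forall>r\<in>torus L. x r \<in> {-d<..<d}")
    case True
    then have "\<bar>x r\<bar> \<le> d" if "r \<in> torus L" for r
      using that by (auto simp: abs_le_iff less_imp_le)
    from boltzmann_weight_le[OF pos(1-3) this] show ?thesis
      using True by (simp add: C_def ennreal_leI flip: ennreal_mult)
  next
    case False
    then have "(\<Prod>r\<in>torus L. indicator {-d<..<d} (x r) :: ennreal) = 0"
      by (intro prod_zero) (auto simp: indicator_def)
    then show ?thesis by (simp only: mult_zero_left zero_le)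
  qed
  have "partition_function J d \<beta> L t
      \<le> (\<integral>\<^sup>+x. ennreal (exp C) * ennreal (exp (- (\<beta> * J / 2 * torus_energy t m L x)))
          \<partial>PiM (torus L) (\<lambda>_. lborel))"
    unfolding partition_function_eq_box_integral[OF d] by (rule nn_integral_mono) (rule pointwise)
  also have "\<dots> = ennreal (exp C)
      * ennreal (exp (- (real L ^ 3 * gaussian_free_energy (stiffness t) (\<beta> * J) m L)))"
    by (subst nn_integral_cmult)
       (use nn_integral_torus_gaussian[of L "\<beta> * J" m "stiffness t"] pos in simp_all)
  finally show ?thesis
    by (simp add: C_def right_diff_distrib flip: ennreal_mult exp_add)
qed

lemma partition_function_ge:
  assumes d: "0 < d" "d \<le> pi" and pos: "J > 0" "\<beta> > 0" "m > 0" "L > 0"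
    and m: "pi\<^sup>2 \<le> 2 * (\<beta> * J) * d\<^sup>2 * m"
  shows "ennreal (exp (real L ^ 3 * (- (12 * (\<beta> * J) * d ^ 3)
      - gaussian_free_energy (stiffness t) (\<beta> * J) m L))) \<le> partition_function J d \<beta> L t"
proof -
  define C where "C = real L ^ 3 * (12 * (\<beta> * J) * d ^ 3)"
  define c where "c = pi / (2 * d)"
  have pointwise: "ennreal (exp (- C)) * ennreal (exp (- (\<beta> * J / 2 * torus_energy t m L x)))
      \<le> (\<Prod>r\<in>torus L. ennreal (1 / (1 + (c * x r)\<^sup>2)))
        * ennreal (exp (- \<beta> * hamiltonian J L (\<lambda>r. t + squash c (x r))))" for x
    using ennreal_leI[OF boltzmann_weight_squash_ge[OF pos(1,2) d(1) c_def m, of L t x]]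
    unfolding C_def by (subst prod_ennreal) (simp_all add: ennreal_mult prod_nonneg)
  have "ennreal (exp (real L ^ 3 * (- (12 * (\<beta> * J) * d ^ 3)
        - gaussian_free_energy (stiffness t) (\<beta> * J) m L)))
      = ennreal (exp (- C))
        * ennreal (exp (- (real L ^ 3 * gaussian_free_energy (stiffness t) (\<beta> * J) m L)))"
    by (simp add: C_def right_diff_distrib flip: ennreal_mult exp_add)
  also have "\<dots> = (\<integral>\<^sup>+x. ennreal (exp (- C)) * ennreal (exp (- (\<beta> * J / 2 * torus_energy t m L x)))
      \<partial>PiM (torus L) (\<lambda>_. lborel))"
    by (subst nn_integral_cmult)
       (use nn_integral_torus_gaussian[of L "\<beta> * J" m "stiffness t"] pos in simp_all)
  also have "\<dots> \<le> partition_function J d \<beta> L t"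
    unfolding partition_function_eq_squash_integral[OF d c_def]
    by (rule nn_integral_mono) (rule pointwise)
  finally show ?thesis .
qed

lemma partition_function_finite:
  assumes "0 < d" "d \<le> pi" "J > 0" "\<beta> > 0" "L > 0"
  shows "partition_function J d \<beta> L t < \<infinity>"
  by (rule le_less_trans[OF partition_function_le[where m = 1]]) (use assms in simp_all)

lemma partition_function_pos:
  assumes d: "0 < d" "d \<le> pi" and pos: "J > 0" "\<beta> > 0" "L > 0"
  shows "0 < enn2real (partition_function J d \<beta> L t)"
proof -
  define m where "m = pi\<^sup>2 / (2 * (\<beta> * J) * d\<^sup>2)"
  have m: "m > 0" "pi\<^sup>2 \<le> 2 * (\<beta> * J) * d\<^sup>2 * m"
    using d pos by (simp_all add: m_def)
  have "0 < partition_function J d \<beta> L t"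
    by (rule less_le_trans[OF _ partition_function_ge[OF d pos(1,2) m(1) pos(3) m(2)]]) simp
  with partition_function_finite[OF assms] show ?thesis
    by (simp add: enn2real_positive_iff)
qed

lemma restricted_free_energy_ge:
  assumes d: "0 < d" "d \<le> pi" and pos: "J > 0" "\<beta> > 0" "m > 0" "L > 0"
  shows "mean_log_dispersion (stiffness t) m L / 2 - (12 * (\<beta> * J) * d ^ 3 + \<beta> * J * m * d\<^sup>2 / 2)
    \<le> restricted_free_energy J d \<beta> L t"
proof -
  define Z where "Z = enn2real (partition_function J d \<beta> L t)"
  have "Z \<le> exp (real L ^ 3 * (12 * (\<beta> * J) * d ^ 3 + \<beta> * J * m * d\<^sup>2 / 2
      - gaussian_free_energy (stiffness t) (\<beta> * J) m L))"
    using enn2real_mono[OF partition_function_le[OF assms] ennreal_less_top] by (simp add: Z_def)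
  moreover have "0 < Z"
    unfolding Z_def by (rule partition_function_pos[OF d pos(1,2,4)])
  ultimately have "ln Z \<le> real L ^ 3 * (12 * (\<beta> * J) * d ^ 3 + \<beta> * J * m * d\<^sup>2 / 2
      - gaussian_free_energy (stiffness t) (\<beta> * J) m L)"
    by (metis exp_gt_zero ln_exp ln_le_cancel_iff)
  then have "ln Z / real L ^ 3 \<le> 12 * (\<beta> * J) * d ^ 3 + \<beta> * J * m * d\<^sup>2 / 2
      - gaussian_free_energy (stiffness t) (\<beta> * J) m L"
    using pos by (simp add: divide_le_eq mult.commute)
  then show ?thesis
    unfolding restricted_free_energy_eq Z_def[symmetric] gaussian_free_energy_def
    by (simp add: add_divide_distrib)
qed

lemma restricted_free_energy_le:
  assumes d: "0 < d" "d \<le> pi" and pos: "J > 0" "\<beta> > 0" "m > 0" "L > 0"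
    and m: "pi\<^sup>2 \<le> 2 * (\<beta> * J) * d\<^sup>2 * m"
  shows "restricted_free_energy J d \<beta> L t
    \<le> mean_log_dispersion (stiffness t) m L / 2 + 12 * (\<beta> * J) * d ^ 3"
proof -
  define Z where "Z = enn2real (partition_function J d \<beta> L t)"
  have "exp (real L ^ 3 * (- (12 * (\<beta> * J) * d ^ 3)
      - gaussian_free_energy (stiffness t) (\<beta> * J) m L)) \<le> Z"
    using enn2real_mono[OF partition_function_ge[OF assms, of t]]
      partition_function_finite[OF d pos(1,2,4), of t]
    by (simp add: Z_def)
  moreover have "0 < Z"
    unfolding Z_def by (rule partition_function_pos[OF d pos(1,2,4)])
  ultimately have "real L ^ 3 * (- (12 * (\<beta> * J) * d ^ 3)
      - gaussian_free_energy (stiffness t) (\<beta> * J) m L) \<le> ln Z"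
    by (simp add: ln_ge_iff)
  then have "- (12 * (\<beta> * J) * d ^ 3)
      - gaussian_free_energy (stiffness t) (\<beta> * J) m L \<le> ln Z / real L ^ 3"
    using pos by (simp add: le_divide_eq mult.commute)
  then show ?thesis
    unfolding restricted_free_energy_eq Z_def[symmetric] gaussian_free_energy_def
    by (simp add: add_divide_distrib)
qed

subsection \<open>Riemann sums over the Brillouin zone\<close>

abbreviation brillouin :: "(real \<times> real \<times> real) set" where
  "brillouin \<equiv> {-pi..pi} \<times> {-pi..pi} \<times> {-pi..pi}"

definition half_open_zone :: "(real \<times> real \<times> real) set" where
  "half_open_zone = {-pi..<pi} \<times> {-pi..<pi} \<times> {-pi..<pi}"

definition cell_index :: "nat \<Rightarrow> real \<Rightarrow> nat" where
  "cell_index L x = nat \<lfloor>(x + pi) * real L / (2 * pi)\<rfloor>"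

definition momentum_cell :: "nat \<Rightarrow> nat \<Rightarrow> real set" where
  "momentum_cell L i = {- pi + 2 * pi * real i / real L ..< - pi + 2 * pi * (real i + 1) / real L}"

lemma mem_brillouin_iff: "k \<in> brillouin \<longleftrightarrow> (\<forall>a. coord k a \<in> {-pi..pi})"
  by (cases k) (simp add: coord_def forall_3)

lemma mem_half_open_zone_iff: "k \<in> half_open_zone \<longleftrightarrow> (\<forall>a. coord k a \<in> {-pi..<pi})"
  by (cases k) (simp add: coord_def forall_3 half_open_zone_def)

lemma half_open_zone_subset: "half_open_zone \<subseteq> brillouin"
  by (auto simp: half_open_zone_def)

lemma compact_brillouin: "compact brillouin"
  by (intro compact_Times compact_Icc)

lemma brillouin_borel [measurable]: "brillouin \<in> sets borel"
  using compact_brillouin by (rule borel_compact)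

lemma AE_lborel_inner_neq:
  fixes a :: "'a::euclidean_space"
  assumes "a \<noteq> 0"
  shows "AE k in lborel. inner a k \<noteq> c"
proof -
  have "{x. inner a x = c} \<in> null_sets lebesgue"
    using negligible_hyperplane[of a c] assms by (simp add: negligible_iff_null_sets)
  then have "{x. inner a x = c} \<in> null_sets lborel"
    by (subst (asm) null_sets_completion_iff) (auto intro!: borel_closed closed_hyperplane)
  from AE_not_in[OF this] show ?thesis by simp
qed

lemma AE_lborel_coord_neq: "AE k :: real \<times> real \<times> real in lborel. \<forall>a. coord k a \<noteq> c"
proof -
  have "AE k :: real \<times> real \<times> real in lborel. coord k a \<noteq> c" for a
  proof -
    define e :: "real \<times> real \<times> real"
      where "e = (if a = 1 then (1, 0, 0) else if a = 2 then (0, 1, 0) else (0, 0, 1))"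
    have "e \<noteq> 0" "inner e k = coord k a" for k
      by (simp_all add: e_def coord_def inner_prod_def zero_prod_def)
    then show ?thesis
      using AE_lborel_inner_neq[of e c] by simp
  qed
  then show ?thesis
    by (simp add: AE_all_countable)
qed

lemma norm_le_sum_coord: "norm k \<le> (\<Sum>a\<in>UNIV. \<bar>coord k a\<bar>)" for k :: "real \<times> real \<times> real"
proof -
  obtain x y z where k: "k = (x, y, z)"
    by (rule prod_cases3)
  have "norm k \<le> norm x + (norm y + norm z)"
    unfolding k by (rule order_trans[OF norm_Pair_le add_left_mono[OF norm_Pair_le]])
  then show ?thesis
    by (simp add: k sum_3 coord_def)
qed

lemma cell_index_eq_iff:
  assumes "L > 0" "- pi \<le> x"
  shows "cell_index L x = i \<longleftrightarrow> x \<in> momentum_cell L i"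
proof -
  define y where "y = (x + pi) * real L / (2 * pi)"
  have y: "0 \<le> y" and x: "x = - pi + 2 * pi * y / real L"
    using assms by (simp_all add: y_def)
  have "cell_index L x = i \<longleftrightarrow> \<lfloor>y\<rfloor> = int i"
    using y by (auto simp: cell_index_def y_def)
  also have "\<dots> \<longleftrightarrow> real i \<le> y \<and> y < real i + 1"
    by (simp add: floor_eq_iff)
  also have "\<dots> \<longleftrightarrow> x \<in> momentum_cell L i"
    using assms by (simp add: x momentum_cell_def divide_le_cancel divide_less_cancel)
  finally show ?thesis .
qed

lemma cell_index_less:
  assumes "L > 0" "x \<in> {-pi..<pi}"
  shows "cell_index L x < L"
proof -
  have "(x + pi) * real L < (2 * pi) * real L"
    using assms by (intro mult_strict_right_mono) auto
  then have "(x + pi) * real L / (2 * pi) < real L"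
    by (simp add: divide_less_eq mult.commute)
  then show ?thesis
    using assms by (simp add: cell_index_def floor_less_iff nat_less_iff)
qed

lemma momentum_cell_index:
  assumes "L > 0" "- pi \<le> x"
  shows "\<bar>momentum L (cell_index L x) - x\<bar> \<le> 2 * pi / real L"
proof -
  define e where "e = real L / 2 - real (L div 2)"
  have e: "0 \<le> e" "e \<le> 1"
  proof -
    have "real L = 2 * real (L div 2) + real (L mod 2)"
      by (metis mult_div_mod_eq of_nat_add of_nat_mult of_nat_numeral)
    moreover have "real (L mod 2) \<le> 1" by simp
    ultimately show "0 \<le> e" "e \<le> 1" unfolding e_def by linarith+
  qed
  define i where "i = cell_index L x"
  have "momentum L i = - pi + 2 * pi * real i / real L + 2 * pi / real L * e"
    using assms(1) by (simp add: momentum_def e_def field_simps)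
  moreover have "0 \<le> 2 * pi / real L * e" "2 * pi / real L * e \<le> 2 * pi / real L * 1"
    using e by (intro mult_nonneg_nonneg mult_left_mono; simp)+
  moreover have "x \<in> momentum_cell L i"
    using cell_index_eq_iff[OF assms, of i] by (simp add: i_def)
  then have "- pi + 2 * pi * real i / real L \<le> x"
      "x < - pi + 2 * pi * real i / real L + 2 * pi / real L"
    by (simp_all add: momentum_cell_def add_divide_distrib distrib_left)
  ultimately show ?thesis
    by (simp add: abs_le_iff i_def)
qed

lemma torus_momentum_in_brillouin:
  assumes "j \<in> torus L"
  shows "torus_momentum L j \<in> brillouin"
proof -
  have "momentum L i \<in> {-pi..pi}" if "i < L" for i
  proof -
    define h where "h = L div 2"
    have "2 * h \<le> L" "L < 2 * h + 2"
      by (simp_all add: h_def)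
    then have "- real L \<le> 2 * (real i - real h)" and "2 * (real i - real h) \<le> real L"
      using that by simp_all
    then have "pi * - real L \<le> pi * (2 * (real i - real h))"
      and "pi * (2 * (real i - real h)) \<le> pi * real L"
      by (intro mult_left_mono; simp)+
    then show ?thesis
      using that by (simp add: momentum_def h_def divide_le_eq le_divide_eq
        mult.assoc mult.left_commute)
  qed
  then show ?thesis
    using assms by (simp add: mem_brillouin_iff torus_momentum_def mem_torus_iff)
qed

lemma LIMSEQ_torus_momentum:
  assumes "k \<in> half_open_zone"
  shows "(\<lambda>L. torus_momentum L (map_coords (cell_index L) k)) \<longlonglongrightarrow> k"
proof -
  have "dist (torus_momentum L (map_coords (cell_index L) k)) k \<le> 6 * pi / real L" if "L > 0" for L
  proof -
    let ?p = "torus_momentum L (map_coords (cell_index L) k)"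
    have "coord (?p - k) a = momentum L (cell_index L (coord k a)) - coord k a" for a
      by (simp add: coord_def torus_momentum_def map_coords_def)
    then have "\<bar>coord (?p - k) a\<bar> \<le> 2 * pi / real L" for a
      using momentum_cell_index[OF that, of "coord k a"] assms by (simp add: mem_half_open_zone_iff)
    then have "(\<Sum>a\<in>UNIV. \<bar>coord (?p - k) a\<bar>) \<le> (\<Sum>a\<in>(UNIV :: 3 set). 2 * pi / real L)"
      by (rule sum_mono)
    with norm_le_sum_coord[of "?p - k"] show ?thesis
      by (simp add: dist_norm)
  qed
  then have "\<forall>\<^sub>F L in sequentially. dist (torus_momentum L (map_coords (cell_index L) k)) k
      \<le> dist (6 * pi / real L) 0"
    by (intro eventually_sequentiallyI[of 1]) simp
  then show ?thesis
    by (rule metric_tendsto_imp_tendsto[OF lim_const_over_n])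
qed

definition zone_cell :: "nat \<Rightarrow> nat \<times> nat \<times> nat \<Rightarrow> (real \<times> real \<times> real) set" where
  "zone_cell L j = {k \<in> half_open_zone. map_coords (cell_index L) k = j}"

lemma zone_cell_eq:
  assumes L: "L > 0" and j: "j \<in> torus L"
  shows "zone_cell L j
    = momentum_cell L (fst j) \<times> momentum_cell L (fst (snd j)) \<times> momentum_cell L (snd (snd j))"
proof -
  have cell_iff: "x \<in> momentum_cell L i \<longleftrightarrow> x \<in> {-pi..<pi} \<and> cell_index L x = i" if "i < L" for x i
  proof -
    have "2 * pi * (real i + 1) / real L \<le> 2 * pi * real L / real L"
      using that by (intro divide_right_mono mult_left_mono) auto
    also have "\<dots> = 2 * pi"
      using L by simp
    finally have "2 * pi * (real i + 1) / real L \<le> 2 * pi" .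
    moreover have "0 \<le> 2 * pi * real i / real L" by simp
    ultimately have "x \<in> {-pi..<pi}" if "x \<in> momentum_cell L i"
      using that unfolding momentum_cell_def atLeastLessThan_iff by linarith
    then show ?thesis
      using cell_index_eq_iff[OF L, of x i] by auto
  qed
  have "k \<in> zone_cell L j \<longleftrightarrow> (\<forall>a. coord k a \<in> momentum_cell L (coord j a))" for k
    using j cell_iff by (auto simp: zone_cell_def mem_half_open_zone_iff
      coord_eq_iff[of _ j] mem_torus_iff)
  then show ?thesis
    by (auto simp: forall_3 coord_def)
qed

lemma emeasure_lborel_Times:
  fixes A :: "'a::euclidean_space set" and B :: "'b::euclidean_space set"
  assumes "A \<in> sets borel" "B \<in> sets borel"
  shows "emeasure lborel (A \<times> B) = emeasure lborel A * emeasure lborel B"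
  unfolding lborel_prod[symmetric] using assms by (intro lborel.emeasure_pair_measure_Times) auto

lemma zone_cell_measure:
  assumes L: "L > 0" and j: "j \<in> torus L"
  shows "zone_cell L j \<in> sets borel"
      "emeasure lborel (zone_cell L j) = ennreal ((2 * pi / real L) ^ 3)"
proof -
  note box = zone_cell_eq[OF assms]
  have [measurable]: "momentum_cell L i \<in> sets borel" for i
    by (simp add: momentum_cell_def)
  have face: "momentum_cell L (fst (snd j)) \<times> momentum_cell L (snd (snd j)) \<in> sets borel"
    unfolding borel_prod[symmetric] by measurable
  then show "zone_cell L j \<in> sets borel"
    unfolding box borel_prod[symmetric, where 'a = real and 'b = "real \<times> real"] by measurable
  have "emeasure lborel (momentum_cell L i) = ennreal (2 * pi / real L)" for i
    by (simp add: momentum_cell_def divide_right_mono add_divide_distrib distrib_left)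
  then show "emeasure lborel (zone_cell L j) = ennreal ((2 * pi / real L) ^ 3)"
    unfolding box using face
    by (simp add: emeasure_lborel_Times power3_eq_cube flip: ennreal_mult)
qed

definition zone_step :: "(real \<times> real \<times> real \<Rightarrow> real) \<Rightarrow> nat \<Rightarrow> real \<times> real \<times> real \<Rightarrow> real" where
  "zone_step g L k = (\<Sum>j\<in>torus L. indicator (zone_cell L j) k * g (torus_momentum L j))"

lemma zone_step_outside: "k \<notin> half_open_zone \<Longrightarrow> zone_step g L k = 0"
  by (simp add: zone_step_def zone_cell_def)

lemma map_cell_index_in_torus:
  "L > 0 \<Longrightarrow> k \<in> half_open_zone \<Longrightarrow> map_coords (cell_index L) k \<in> torus L"
  by (simp add: mem_torus_iff mem_half_open_zone_iff cell_index_less)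

lemma zone_step_inside:
  assumes "L > 0" and k: "k \<in> half_open_zone"
  shows "zone_step g L k = g (torus_momentum L (map_coords (cell_index L) k))"
proof -
  have "zone_step g L k =
      (\<Sum>j\<in>torus L. if j = map_coords (cell_index L) k then g (torus_momentum L j) else 0)"
    unfolding zone_step_def using k by (intro sum.cong) (auto simp: zone_cell_def indicator_def)
  then show ?thesis
    using map_cell_index_in_torus[OF assms] by simp
qed

lemma zone_step_measurable [measurable]: "zone_step g L \<in> borel_measurable borel"
  unfolding zone_step_def[abs_def]
  by (intro borel_measurable_sum borel_measurable_times borel_measurable_indicator
      borel_measurable_const zone_cell_measure(1)[OF torus_imp_pos])

lemma integral_zone_step:
  "integral\<^sup>L lborel (zone_step g L)
      = (2 * pi) ^ 3 * ((\<Sum>j\<in>torus L. g (torus_momentum L j)) / real L ^ 3)"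
proof -
  have "integral\<^sup>L lborel (zone_step g L)
      = (\<Sum>j\<in>torus L. (2 * pi / real L) ^ 3 * g (torus_momentum L j))"
    unfolding zone_step_def[abs_def] using zone_cell_measure[OF torus_imp_pos]
    by (subst Bochner_Integration.integral_sum) (simp_all add: measure_def)
  then show ?thesis
    by (simp add: power_divide sum_distrib_left sum_divide_distrib)
qed

lemma abs_zone_step_le:
  assumes bound: "\<And>k. k \<in> brillouin \<Longrightarrow> \<bar>g k\<bar> \<le> B"
  shows "\<bar>zone_step g L k\<bar> \<le> indicator brillouin k * B"
proof (cases "k \<in> half_open_zone \<and> L > 0")
  case True
  moreover from True have "k \<in> brillouin"
    using half_open_zone_subset by blast
  ultimately show ?thesis
    using bound[OF torus_momentum_in_brillouin[OF map_cell_index_in_torus]]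
    by (simp add: zone_step_inside)
next
  case False
  then have "zone_step g L k = 0"
    by (cases "L > 0") (simp_all add: zone_step_outside, simp add: zone_step_def torus_def)
  then show ?thesis
    using bound[of 0] by (simp add: zero_prod_def indicator_def)
qed

lemma LIMSEQ_zone_step:
  assumes cont: "continuous_on brillouin g" and k: "k \<in> half_open_zone"
  shows "(\<lambda>L. zone_step g L k) \<longlonglongrightarrow> g k"
proof -
  have "\<forall>\<^sub>F L in sequentially. torus_momentum L (map_coords (cell_index L) k) \<in> brillouin"
    using k by (intro eventually_sequentiallyI[of 1] torus_momentum_in_brillouin
      map_cell_index_in_torus) simp_all
  moreover have "k \<in> brillouin"
    using k half_open_zone_subset by blast
  ultimately have "(\<lambda>L. g (torus_momentum L (map_coords (cell_index L) k))) \<longlonglongrightarrow> g k"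
    by (intro continuous_on_tendsto_compose[OF cont] LIMSEQ_torus_momentum k)
  moreover have "\<forall>\<^sub>F L in sequentially. g (torus_momentum L (map_coords (cell_index L) k))
      = zone_step g L k"
    using k by (intro eventually_sequentiallyI[of 1]) (simp add: zone_step_inside)
  ultimately show ?thesis
    by (rule Lim_transform_eventually)
qed

lemma riemann_sum_torus:
  fixes g :: "real \<times> real \<times> real \<Rightarrow> real"
  assumes cont: "continuous_on brillouin g"
  shows "(\<lambda>L. (\<Sum>j\<in>torus L. g (torus_momentum L j)) / real L ^ 3)
     \<longlonglongrightarrow> (LINT k:brillouin|lborel. g k) / (2 * pi) ^ 3"
proof -
  obtain B where B: "\<And>k. k \<in> brillouin \<Longrightarrow> \<bar>g k\<bar> \<le> B"
    using compact_imp_bounded[OF compact_continuous_image[OF cont compact_brillouin]]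
    by (auto simp: bounded_iff)
  have "(\<lambda>L. integral\<^sup>L lborel (zone_step g L)) \<longlonglongrightarrow> (\<integral>k. indicator brillouin k * g k \<partial>lborel)"
  proof (rule integral_dominated_convergence)
    show "integrable lborel (\<lambda>k. indicator brillouin k * B)"
      using borel_integrable_compact[OF compact_brillouin, of "\<lambda>_. B"] by simp
    show "(\<lambda>k. indicator brillouin k * g k) \<in> borel_measurable lborel"
      using borel_integrable_compact[OF compact_brillouin cont] by simp
    show "AE k in lborel. (\<lambda>L. zone_step g L k) \<longlonglongrightarrow> indicator brillouin k * g k"
      using AE_lborel_coord_neq[of pi]
    proof eventually_elim
      case (elim k)
      then have "k \<in> brillouin \<longleftrightarrow> k \<in> half_open_zone"
        by (auto simp: mem_brillouin_iff mem_half_open_zone_iff less_le)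
      then show ?case
        using LIMSEQ_zone_step[OF cont, of k] by (cases "k \<in> half_open_zone")
           (simp_all add: zone_step_outside)
    qed
    show "AE k in lborel. norm (zone_step g L k) \<le> indicator brillouin k * B" for L
      using abs_zone_step_le[OF B] by simp
  qed simp
  then have "(\<lambda>L. integral\<^sup>L lborel (zone_step g L) / (2 * pi) ^ 3)
      \<longlonglongrightarrow> (LINT k:brillouin|lborel. g k) / (2 * pi) ^ 3"
    by (intro tendsto_divide tendsto_const) (simp_all add: set_lebesgue_integral_def)
  then show ?thesis
    by (simp add: integral_zone_step)
qed

subsection \<open>The massless limit\<close>

lemma integrable_lborel_pair_mult:
  fixes f :: "'a::euclidean_space \<Rightarrow> real" and g :: "'b::euclidean_space \<Rightarrow> real"
  assumes f: "integrable lborel f" and g: "integrable lborel g"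
  shows "integrable lborel (\<lambda>k. f (fst k) * g (snd k))"
proof -
  have [measurable]: "f \<in> borel_measurable borel" "g \<in> borel_measurable borel"
    using f g by (auto dest: borel_measurable_integrable)
  have "integrable (lborel \<Otimes>\<^sub>M lborel) (\<lambda>k. f (fst k) * g (snd k))"
  proof (rule lborel_pair.Fubini_integrable)
    show "integrable lborel (\<lambda>x. \<integral>y. norm (f (fst (x, y)) * g (snd (x, y))) \<partial>lborel)"
      using f by (simp add: abs_mult)
    show "AE x in lborel. integrable lborel (\<lambda>y. f (fst (x, y)) * g (snd (x, y)))"
      using g by simp
  qed measurable
  then show ?thesis by (simp add: lborel_prod)
qed

lemma set_integrable_coord:
  fixes f :: "real \<Rightarrow> real"
  assumes f: "set_integrable lborel A f" and A: "A \<in> sets lborel" "emeasure lborel A < \<infinity>"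
  shows "set_integrable lborel (A \<times> A \<times> A) (\<lambda>k. f (coord k a))"
proof -
  define u where "u = (\<lambda>x. indicator A x * f x)"
  define e :: "real \<Rightarrow> real" where "e = indicator A"
  have u: "integrable lborel u"
    using f by (simp add: set_integrable_def u_def)
  have e: "integrable lborel e"
    using A by (simp add: e_def)
  note products = integrable_lborel_pair_mult[OF u integrable_lborel_pair_mult[OF e e]]
    integrable_lborel_pair_mult[OF e integrable_lborel_pair_mult[OF u e]]
    integrable_lborel_pair_mult[OF e integrable_lborel_pair_mult[OF e u]]
  have "a = 1 \<or> a = 2 \<or> a = 3"
    by (rule exhaust_3)
  then show ?thesis
    unfolding set_integrable_def using products
    by (auto simp: coord_def u_def e_def indicator_times mult_ac)
qed

lemma set_integrable_abs_powr:
  assumes p: "p > -1" and r: "r \<ge> 0"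
  shows "set_integrable lborel {-r..r} (\<lambda>x::real. \<bar>x\<bar> powr p)"
proof -
  define f where "f = (\<lambda>x::real. \<bar>x\<bar> powr p)"
  have right: "f integrable_on {0..r}"
    using integrable_on_powr_from_0[OF p r] by (rule integrable_eq) (auto simp: f_def)
  have "(\<lambda>x. f (- x)) integrable_on {- r..- 0} \<longleftrightarrow> f integrable_on {0..r}"
    by (rule Henstock_Kurzweil_Integration.integrable_reflect_real)
  then have left: "f integrable_on {-r..0}"
    using right by (simp add: f_def)
  have "f integrable_on {-r..r}"
    by (rule Henstock_Kurzweil_Integration.integrable_combine[OF _ _ left right]) (use r in auto)
  then have "f absolutely_integrable_on {-r..r}"
    by (rule nonnegative_absolutely_integrable_1) (auto simp: f_def)
  then show ?thesis
    unfolding set_integrable_def by (subst (asm) integrable_completion) (auto simp: f_def)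
qed

definition singular_majorant :: "real \<times> real \<times> real \<Rightarrow> real" where
  "singular_majorant k = (\<Sum>a\<in>UNIV. \<bar>coord k a\<bar> powr (-1/2))"

lemma set_integrable_singular_majorant: "set_integrable lborel brillouin singular_majorant"
proof -
  have "set_integrable lborel brillouin (\<lambda>k. \<bar>coord k a\<bar> powr (-1/2))" for a
    by (rule set_integrable_coord[OF set_integrable_abs_powr]) simp_all
  then show ?thesis
    unfolding set_integrable_def singular_majorant_def scaleR_sum_right
    by (intro Bochner_Integration.integrable_sum)
qed

lemma one_minus_cos_ge:
  assumes "\<bar>x\<bar> \<le> pi"
  shows "x\<^sup>2 / 8 \<le> 1 - cos x"
proof -
  define y where "y = \<bar>x\<bar> / 2"
  have y: "0 \<le> y" "y \<le> 16 / 10"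
    using assms pi_approx by (simp_all add: y_def)
  have "\<bar>sin y - y\<bar> \<le> y * y\<^sup>2 / 6"
    using Maclaurin_sin_bound[of y 3] y by (simp add: sin_coeff_def eval_nat_numeral mult.assoc)
  moreover have "y * y\<^sup>2 \<le> y * 3"
    using y power_mono[OF y(2) y(1), of 2] by (intro mult_left_mono)
       (simp_all add: power2_eq_square)
  ultimately have "y / 2 \<le> sin y"
    by linarith
  then have "(y / 2)\<^sup>2 \<le> (sin y)\<^sup>2"
    using y by (intro power_mono) simp_all
  moreover have "cos x = 1 - 2 * (sin y)\<^sup>2"
    using cos_double_sin[of y] by (simp add: y_def)
  ultimately show ?thesis
    by (simp add: y_def power_divide)
qed

lemma dispersion_ge:
  assumes q: "\<And>a. 0 \<le> q a" and k: "k \<in> brillouin"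
  shows "q a * ((coord k a)\<^sup>2 / 4) \<le> dispersion q (coord k)"
proof -
  have "\<bar>coord k a\<bar> \<le> pi"
    using k[unfolded mem_brillouin_iff, rule_format, of a] by (simp add: abs_le_iff)
  then have "q a * ((coord k a)\<^sup>2 / 4) \<le> q a * (2 - 2 * cos (coord k a))"
    using one_minus_cos_ge[of "coord k a"] q by (intro mult_left_mono) simp_all
  also have "\<dots> \<le> dispersion q (coord k)"
    unfolding dispersion_def using q by (intro member_le_sum) simp_all
  finally show ?thesis .
qed

lemma powr_one_plus_le:
  fixes x :: real
  assumes x: "0 \<le> x" and a: "0 < a" "a \<le> 1"
  shows "(1 + x) powr a \<le> 1 + x powr a"
proof -
  have "1 = 1 / (1 + x) + x / (1 + x)"
    using x by (simp flip: add_divide_distrib)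
  also have "\<dots> \<le> (1 / (1 + x)) powr a + (x / (1 + x)) powr a"
    using x a powr_mono'[of a 1 "1 / (1 + x)"] powr_mono'[of a 1 "x / (1 + x)"]
    by (intro add_mono) (simp_all add: divide_le_eq)
  also have "\<dots> = (1 + x powr a) / (1 + x) powr a"
    using x by (simp add: powr_divide add_divide_distrib)
  finally show ?thesis
    using x by (simp add: le_divide_eq)
qed

lemma ln_one_plus_le_powr:
  fixes x :: real
  assumes x: "0 \<le> x" and a: "0 < a" "a \<le> 1"
  shows "ln (1 + x) \<le> x powr a / a"
proof -
  have "a * ln (1 + x) = ln ((1 + x) powr a)"
    using x by (simp add: ln_powr)
  also have "\<dots> \<le> ln (1 + x powr a)"
    using powr_one_plus_le[OF assms] x by (subst ln_le_cancel_iff) (simp_all add: add_pos_nonneg)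
  also have "\<dots> \<le> x powr a"
    by (rule ln_add_one_self_le_self) simp
  finally show ?thesis
    using a by (simp add: le_divide_eq mult.commute)
qed

lemma ln_add_diff_le:
  fixes D m :: real
  assumes D: "0 < D" "D \<le> D'" and m: "0 < m" and a: "0 < a" "a \<le> 1"
  shows "ln (D' + m) - ln D' \<le> (m / D) powr a / a"
proof -
  have "1 + m / D' = (D' + m) / D'"
    using D by (simp add: add_divide_distrib)
  then have "ln (D' + m) - ln D' = ln (1 + m / D')"
    using D m by (simp add: ln_div)
  also have "\<dots> \<le> (m / D') powr a / a"
    using D m a by (intro ln_one_plus_le_powr) simp_all
  also have "\<dots> \<le> (m / D) powr a / a"
    using D m a by (intro divide_right_mono powr_mono2 divide_left_mono) simp_all
  finally show ?thesis .
qed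

lemma ln_dispersion_gap:
  assumes q: "\<And>a. 0 \<le> q a" and c: "0 < c" "c \<le> q a" and m: "0 < m"
    and k: "k \<in> brillouin" "coord k a \<noteq> 0"
  shows "ln (dispersion q (coord k)) \<le> ln (dispersion q (coord k) + m)"
    and "ln (dispersion q (coord k) + m) - ln (dispersion q (coord k))
      \<le> 4 * (4 * m / c) powr (1/4) * singular_majorant k"
proof -
  define D where "D = dispersion q (coord k)"
  define x where "x = coord k a"
  have x: "x \<noteq> 0"
    using k by (simp add: x_def)
  then have x_powr: "\<bar>x\<bar> powr (-2) = 1 / x\<^sup>2"
    using powr_realpow[of "\<bar>x\<bar>" 2] by (simp add: powr_minus divide_inverse)
  have x_pos: "0 < c * (x\<^sup>2 / 4)"
    using c x by simp
  have "c * (x\<^sup>2 / 4) \<le> q a * (x\<^sup>2 / 4)"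
    using c by (intro mult_right_mono) simp_all
  then have D_ge: "c * (x\<^sup>2 / 4) \<le> D"
    using dispersion_ge[where q = q and a = a, OF q k(1)] by (simp add: D_def x_def)
  then show "ln (dispersion q (coord k)) \<le> ln (dispersion q (coord k) + m)"
    using x_pos m by (simp add: D_def)
  have "ln (D + m) - ln D \<le> (m / (c * (x\<^sup>2 / 4))) powr (1/4) / (1/4)"
    by (rule ln_add_diff_le[OF x_pos D_ge m]) simp_all
  also have "m / (c * (x\<^sup>2 / 4)) = 4 * m / c * \<bar>x\<bar> powr (-2)"
    by (simp add: x_powr)
  also have "(4 * m / c * \<bar>x\<bar> powr (-2)) powr (1/4) / (1/4)
      = 4 * (4 * m / c) powr (1/4) * \<bar>x\<bar> powr (-1/2)"
    using m c by (subst powr_mult) (simp_all add: powr_powr)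
  also have "\<bar>x\<bar> powr (-1/2) \<le> singular_majorant k"
    unfolding singular_majorant_def x_def by (rule member_le_sum) simp_all
  finally show "ln (dispersion q (coord k) + m) - ln (dispersion q (coord k))
      \<le> 4 * (4 * m / c) powr (1/4) * singular_majorant k"
    using m c by (simp add: D_def mult_left_mono)
qed

lemma continuous_on_coord [continuous_intros]:
  "continuous_on S (\<lambda>k :: real \<times> real \<times> real. coord k a)"
  unfolding coord_def by (cases "a = 1"; cases "a = 2") (auto intro!: continuous_intros)

lemma continuous_on_ln_dispersion:
  assumes q: "\<And>a. 0 \<le> q a" and m: "0 < m"
  shows "continuous_on S (\<lambda>k. ln (dispersion q (coord k) + m))"
proof -
  have "dispersion q (coord k) + m \<noteq> 0" for k
    using dispersion_nonneg[of q "coord k"] q m by (metis add_nonneg_pos less_irrefl)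
  then show ?thesis
    unfolding dispersion_def by (intro continuous_intros ballI) auto
qed

lemma set_integrable_ln_dispersion_massive:
  assumes q: "\<And>a. 0 \<le> q a" and m: "0 < m"
  shows "set_integrable lborel brillouin (\<lambda>k. ln (dispersion q (coord k) + m))"
  unfolding set_integrable_def
  by (rule borel_integrable_compact[OF compact_brillouin continuous_on_ln_dispersion[OF q m]])

lemma set_integrable_ln_dispersion:
  assumes q: "\<And>a. 0 \<le> q a" and c: "0 < c" "c \<le> q a"
  shows "set_integrable lborel brillouin (\<lambda>k. ln (dispersion q (coord k)))"
proof -
  define gap where "gap = (\<lambda>k. ln (dispersion q (coord k) + 1) - ln (dispersion q (coord k)))"
  have [measurable]: "(\<lambda>k. dispersion q (coord k)) \<in> borel_measurable borel"
    unfolding dispersion_def by (intro borel_measurable_continuous_onI continuous_intros)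
  have "set_integrable lborel brillouin gap"
  proof (rule set_integrable_bound)
    show "set_integrable lborel brillouin (\<lambda>k. 4 * (4 * 1 / c) powr (1/4) * singular_majorant k)"
      using set_integrable_singular_majorant by (rule set_integrable_mult_right)
    show "set_borel_measurable lborel brillouin gap"
      unfolding set_borel_measurable_def gap_def by measurable
    show "AE k in lborel. k \<in> brillouin \<longrightarrow> norm (gap k)
        \<le> norm (4 * (4 * 1 / c) powr (1/4) * singular_majorant k)"
      using AE_lborel_coord_neq[of 0]
    proof eventually_elim
      case (elim k)
      show ?case
        using ln_dispersion_gap[where q = q and a = a and m = 1, OF q c _, of k] elim
        by (auto simp: gap_def)
    qed
  qed
  moreover have "set_integrable lborel brillouin (\<lambda>k. ln (dispersion q (coord k) + 1))"
    using q by (rule set_integrable_ln_dispersion_massive) simp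
  ultimately have "set_integrable lborel brillouin (\<lambda>k. ln (dispersion q (coord k) + 1) - gap k)"
    by (intro set_integral_diff(1))
  then show ?thesis by (simp add: gap_def)
qed

definition spin_wave_integral :: "(3 \<Rightarrow> real) \<Rightarrow> real \<Rightarrow> real" where
  "spin_wave_integral q m =
    (LINT k:brillouin|lborel. ln (dispersion q (coord k) + m)) / (2 * pi) ^ 3"

lemma mean_log_dispersion_tendsto:
  assumes "\<And>a. 0 \<le> q a" "0 < m"
  shows "mean_log_dispersion q m \<longlonglongrightarrow> spin_wave_integral q m"
  unfolding spin_wave_integral_def mean_log_dispersion_def[abs_def]
  by (rule riemann_sum_torus[OF continuous_on_ln_dispersion[OF assms]])

lemma spin_wave_integral_mass:
  assumes q: "\<And>a. 0 \<le> q a" and c: "0 < c" "c \<le> q a" and m: "0 < m"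
  shows "spin_wave_integral q 0 \<le> spin_wave_integral q m"
    and "spin_wave_integral q m - spin_wave_integral q 0
      \<le> (4 * m / c) powr (1/4) * (4 * (LINT k:brillouin|lborel. singular_majorant k) / (2 * pi) ^ 3)"
proof -
  let ?I = "\<lambda>m. LINT k:brillouin|lborel. ln (dispersion q (coord k) + m)"
  note massless = set_integrable_ln_dispersion[where q = q and a = a, OF q c]
    and massive = set_integrable_ln_dispersion_massive[OF q m]
  have gap: "AE k in lborel. k \<in> brillouin \<longrightarrow>
      ln (dispersion q (coord k)) \<le> ln (dispersion q (coord k) + m)
      \<and> ln (dispersion q (coord k) + m) - ln (dispersion q (coord k))
        \<le> 4 * (4 * m / c) powr (1/4) * singular_majorant k"
    using AE_lborel_coord_neq[of 0]
    by eventually_elim (use ln_dispersion_gap[where q = q and a = a, OF q c m] in blast)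
  have "?I 0 \<le> ?I m"
    using set_integral_mono_AE[OF massless massive] gap by (simp add: eventually_mono)
  then show "spin_wave_integral q 0 \<le> spin_wave_integral q m"
    by (simp add: spin_wave_integral_def divide_right_mono)
  have "?I m - ?I 0
      = (LINT k:brillouin|lborel. ln (dispersion q (coord k) + m) - ln (dispersion q (coord k)))"
    using set_integral_diff(2)[OF massive massless] by simp
  also have "\<dots> \<le> (LINT k:brillouin|lborel. 4 * (4 * m / c) powr (1/4) * singular_majorant k)"
    by (rule set_integral_mono_AE[OF set_integral_diff(1)[OF massive massless]
          set_integrable_mult_right[OF set_integrable_singular_majorant]])
       (use gap in eventually_elim, blast)
  also have "\<dots> = (4 * m / c) powr (1/4) * (4 * (LINT k:brillouin|lborel. singular_majorant k))"
    by simp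
  finally have "(?I m - ?I 0) / (2 * pi) ^ 3
      \<le> (4 * m / c) powr (1/4) * (4 * (LINT k:brillouin|lborel. singular_majorant k)) / (2 * pi) ^ 3"
    by (rule divide_right_mono) simp
  then show "spin_wave_integral q m - spin_wave_integral q 0
      \<le> (4 * m / c) powr (1/4) * (4 * (LINT k:brillouin|lborel. singular_majorant k) / (2 * pi) ^ 3)"
    by (simp add: spin_wave_integral_def diff_divide_distrib)
qed

lemma spin_wave_integral_small_mass:
  assumes c: "0 < c" and \<epsilon>: "0 < \<epsilon>"
  shows "\<exists>m>0. \<forall>q a. (\<forall>b. 0 \<le> q b) \<and> c \<le> q a \<longrightarrow>
    spin_wave_integral q m - spin_wave_integral q 0 < \<epsilon>"
proof -
  define K where "K = 4 * (LINT k:brillouin|lborel. singular_majorant k) / (2 * pi) ^ 3"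
  have "\<forall>\<^sub>F m in at_right 0. 0 \<le> 4 * m / c"
    using eventually_at_right_less[of 0] by eventually_elim (use c in simp)
  then have "((\<lambda>m. (4 * m / c) powr (1/4) * K) \<longlongrightarrow> (4 * 0 / c) powr (1/4) * K) (at_right 0)"
    using c by (intro tendsto_mult_right tendsto_powr' tendsto_intros) auto
  then have "\<forall>\<^sub>F m in at_right 0. (4 * m / c) powr (1/4) * K < \<epsilon>"
    using \<epsilon> by (intro order_tendstoD) auto
  with eventually_at_right_less[of 0]
  have "\<forall>\<^sub>F m in at_right 0. 0 < m \<and> (4 * m / c) powr (1/4) * K < \<epsilon>"
    by (rule eventually_conj)
  then obtain m where m: "0 < m" "(4 * m / c) powr (1/4) * K < \<epsilon>"
    using eventually_happens'[OF trivial_limit_at_right_real] by blast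
  have "spin_wave_integral q m - spin_wave_integral q 0 < \<epsilon>" if "\<forall>b. 0 \<le> q b" "c \<le> q a" for q a
    using spin_wave_integral_mass(2)[where q = q and a = a, OF _ c that(2) m(1)] that m(2)
    unfolding K_def by (meson le_less_trans)
  with m(1) show ?thesis by blast
qed

subsection \<open>The spin-wave free energy\<close>

lemma exists_stiffness_ge_half: "\<exists>a. 1 / 2 \<le> stiffness t a"
proof -
  have "(sin (t - 2 * pi / 3))\<^sup>2 + (sin (t + 2 * pi / 3))\<^sup>2 = (sin t)\<^sup>2 / 2 + 3 / 2 * (cos t)\<^sup>2"
    unfolding sin_diff sin_add cos_120 sin_120 by (simp add: power2_eq_square algebra_simps)
  moreover have "stiffness t 1 + stiffness t 2 + stiffness t 3
      = (sin t)\<^sup>2 + (sin (t - 2 * pi / 3))\<^sup>2 + (sin (t + 2 * pi / 3))\<^sup>2"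
    by (simp add: stiffness_def axis_angle_def)
  ultimately have "stiffness t 1 + stiffness t 2 + stiffness t 3 = 3 / 2"
    using sin_cos_squared_add[of t] by linarith
  then have "1 / 2 \<le> stiffness t 1 \<or> 1 / 2 \<le> stiffness t 2 \<or> 1 / 2 \<le> stiffness t 3"
    by linarith
  then show ?thesis by blast
qed

lemma spin_wave_free_energy_eq: "spin_wave_free_energy t = spin_wave_integral (stiffness t) 0 / 2"
proof -
  have "(cmod (1 - cis x))\<^sup>2 = 2 - 2 * cos x" for x
    unfolding cmod_power2 using sin_cos_squared_add[of x]
    by (simp add: power2_eq_square algebra_simps)
  then show ?thesis
    by (simp add: spin_wave_free_energy_def spin_wave_integral_def Let_def dispersion_def sum_3
        stiffness_def axis_angle_def coord_def)
qed

lemma restricted_free_energy_eventually_close: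
  assumes d: "0 < d" "d \<le> pi" and pos: "J > 0" "\<beta> > 0" "m > 0" and \<epsilon>: "\<epsilon> > 0"
    and cubic: "12 * (\<beta> * J) * d ^ 3 \<le> \<epsilon> / 4" and quadratic: "pi\<^sup>2 \<le> 2 * (\<beta> * J) * d\<^sup>2 * m"
    and mass: "spin_wave_integral (stiffness t) m - spin_wave_integral (stiffness t) 0 \<le> \<epsilon>"
  shows "\<forall>\<^sub>F L in sequentially. \<bar>restricted_free_energy J d \<beta> L t - spin_wave_free_energy t\<bar> \<le> \<epsilon>"
proof -
  let ?mean = "mean_log_dispersion (stiffness t)" and ?limit = "spin_wave_integral (stiffness t)"
  define m' where "m' = \<epsilon> / (2 * (\<beta> * J * d\<^sup>2))"
  have m': "m' > 0" "\<beta> * J * m' * d\<^sup>2 / 2 = \<epsilon> / 4"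
    using pos d \<epsilon> by (simp_all add: m'_def)
  obtain a where "1 / 2 \<le> stiffness t a"
    using exists_stiffness_ge_half by blast
  then have mono: "?limit 0 \<le> ?limit m'"
    by (intro spin_wave_integral_mass(1)[of _ "1 / 2" a] m') simp_all
  have "\<forall>\<^sub>F L in sequentially. dist (?mean m L) (?limit m) < \<epsilon> / 2" if "m > 0" for m
    using mean_log_dispersion_tendsto[OF stiffness_nonneg that] \<epsilon> by (intro tendstoD) simp_all
  from this[OF m'(1)] this[OF pos(3)] eventually_gt_at_top[of 0] show ?thesis
  proof eventually_elim
    case (elim L)
    note lower = restricted_free_energy_ge[OF d pos(1,2) m'(1) elim(3), of t]
      and upper = restricted_free_energy_le[OF d pos elim(3) quadratic, of t]
    show ?case
      using lower upper mono mass cubic elim(1,2)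
      unfolding m'(2) spin_wave_free_energy_eq dist_real_def by linarith
  qed
qed

lemma restricted_free_energy_uniformly_close:
  assumes J: "J > 0" and \<epsilon>: "\<epsilon> > 0"
  shows "\<exists>\<delta>>0. \<forall>\<beta> d t. \<beta> > 0 \<and> 0 < d \<and> d \<le> pi \<and> 1 / \<delta> \<le> (\<beta> * J) * d\<^sup>2 \<and> (\<beta> * J) * d ^ 3 \<le> \<delta> \<longrightarrow>
    (\<forall>\<^sub>F L in sequentially. \<bar>restricted_free_energy J d \<beta> L t - spin_wave_free_energy t\<bar> \<le> \<epsilon>)"
proof -
  obtain m where m: "0 < m" and mass: "\<And>q a. \<forall>b. 0 \<le> q b \<Longrightarrow> 1 / 2 \<le> q a \<Longrightarrow>
      spin_wave_integral q m - spin_wave_integral q 0 < \<epsilon>"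
    using spin_wave_integral_small_mass[of "1 / 2" \<epsilon>] \<epsilon> by auto
  define \<delta> where "\<delta> = min (\<epsilon> / 48) (2 * m / pi\<^sup>2)"
  have \<delta>: "\<delta> > 0" "pi\<^sup>2 / (2 * m) \<le> 1 / \<delta>"
    using \<epsilon> m by (simp_all add: \<delta>_def min_def divide_simps mult_ac)
  have "\<forall>\<^sub>F L in sequentially. \<bar>restricted_free_energy J d \<beta> L t - spin_wave_free_energy t\<bar> \<le> \<epsilon>"
    if pos: "\<beta> > 0" and d: "0 < d" "d \<le> pi" and quadratic: "1 / \<delta> \<le> (\<beta> * J) * d\<^sup>2"
      and cubic: "(\<beta> * J) * d ^ 3 \<le> \<delta>" for \<beta> d t
  proof (rule restricted_free_energy_eventually_close[OF d J pos m \<epsilon>])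
    show "12 * (\<beta> * J) * d ^ 3 \<le> \<epsilon> / 4"
      using cubic by (simp add: \<delta>_def)
    have "pi\<^sup>2 / (2 * m) \<le> (\<beta> * J) * d\<^sup>2"
      using \<delta>(2) quadratic by (rule order_trans)
    then show "pi\<^sup>2 \<le> 2 * (\<beta> * J) * d\<^sup>2 * m"
      using m by (simp add: divide_le_eq mult_ac)
    show "spin_wave_integral (stiffness t) m - spin_wave_integral (stiffness t) 0 \<le> \<epsilon>"
      using mass[of "stiffness t"] exists_stiffness_ge_half[of t] by (auto intro: less_imp_le)
  qed
  with \<delta>(1) show ?thesis by blast
qed

theorem theorem4p1:
  fixes J :: real
  assumes "J > 0"
  shows "\<forall>\<epsilon>>0. \<exists>\<delta>>0. \<forall>\<beta> \<Delta>. \<beta> > 0 \<and> 0 < \<Delta> \<and> \<Delta> < 1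
            \<and> (\<beta> * J) * \<Delta>\<^sup>2 \<ge> 1 / \<delta> \<and> (\<beta> * J) * \<Delta> ^ 3 \<le> \<delta> \<longrightarrow>
           (\<forall>\<theta>s. 0 \<le> \<theta>s \<and> \<theta>s < 2 * pi \<longrightarrow>
              limsup (\<lambda>L. ereal \<bar>restricted_free_energy J \<Delta> \<beta> L \<theta>s
                                  - spin_wave_free_energy \<theta>s\<bar>) \<le> ereal \<epsilon>)"
proof (intro allI impI)
  fix \<epsilon> :: real assume "\<epsilon> > 0"
  then obtain \<delta> where "\<delta> > 0" and close: "\<And>\<beta> \<Delta> \<theta>s. \<beta> > 0 \<and> 0 < \<Delta> \<and> \<Delta> \<le> pi
      \<and> 1 / \<delta> \<le> (\<beta> * J) * \<Delta>\<^sup>2 \<and> (\<beta> * J) * \<Delta> ^ 3 \<le> \<delta> \<Longrightarrow>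
      \<forall>\<^sub>F L in sequentially. \<bar>restricted_free_energy J \<Delta> \<beta> L \<theta>s - spin_wave_free_energy \<theta>s\<bar> \<le> \<epsilon>"
    using restricted_free_energy_uniformly_close[OF assms] by blast
  have "limsup (\<lambda>L. ereal \<bar>restricted_free_energy J \<Delta> \<beta> L \<theta>s - spin_wave_free_energy \<theta>s\<bar>) \<le> ereal \<epsilon>"
    if "\<beta> > 0" "0 < \<Delta>" "\<Delta> < 1" "1 / \<delta> \<le> (\<beta> * J) * \<Delta>\<^sup>2" "(\<beta> * J) * \<Delta> ^ 3 \<le> \<delta>" for \<beta> \<Delta> \<theta>s
    using close[of \<beta> \<Delta> \<theta>s] that pi_gt3 by (intro Limsup_bounded) simp
  with \<open>\<delta> > 0\<close> show "\<exists>\<delta>>0. \<forall>\<beta> \<Delta>. \<beta> > 0 \<and> 0 < \<Delta> \<and> \<Delta> < 1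
            \<and> (\<beta> * J) * \<Delta>\<^sup>2 \<ge> 1 / \<delta> \<and> (\<beta> * J) * \<Delta> ^ 3 \<le> \<delta> \<longrightarrow>
           (\<forall>\<theta>s. 0 \<le> \<theta>s \<and> \<theta>s < 2 * pi \<longrightarrow>
              limsup (\<lambda>L. ereal \<bar>restricted_free_energy J \<Delta> \<beta> L \<theta>s
                                  - spin_wave_free_energy \<theta>s\<bar>) \<le> ereal \<epsilon>)"
    by blast
qed

end
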